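(* Assume that [Noise], [Factors], [Portfolio], [Growth] and [Minorization] (as described in the context) hold. Then there exists $\gamma_0<0$ such that for every $\gamma\in(\gamma_0,0)$ there exist a unique (up to an additive constant) function $u_\gamma\in\mathcal{C}_\omega(\mathbb{R}^k)$ and a constant $\lambda_\gamma\in\mathbb{R}$ which solve the Bellman equation $$u_\gamma(x)+\lambda_\gamma\gamma=\inf_{h\in U}\ln\mathbb{E}\big[e^{\gamma F(x,h,W_0)+u_\gamma(G(x,W_0))}\big],\qquad x\in\mathbb{R}^k.$$
   Context: Time set $\mathbb{T}=\mathbb{N}=\{0,1,2,\dots\}$; $(\Omega,\mathcal{F},\{\mathcal{F}_t\}_{t\in\mathbb{T}},\mathbb{P})$ is a filtered probability space with $\mathcal{F}_0$ trivial and $\mathcal{F}=\bigcup_t\mathcal{F}_t$; $\mathbb{E}$ is expectation under $\mathbb{P}$. $k,m$ are positive integers, $U\subset\mathbb{R}^m$ is a nonempty compact set, and $\mathcal{A}$ is the set of all $U$-valued adapted processes $H=(H_t)_{t\in\mathbb{T}}$ (portfolio strategies). $\mathcal{B}(\mathbb{R}^k)$ is the Borel $\sigma$-algebra. [Noise] The filtration is generated by a sequence $W=(W_t)_{t\in\mathbb{T}}$ of i.i.d. $\mathbb{R}^{k+m}$-valued random vectors, with $W_t$ independent of $\mathcal{F}_t$ for each $t$. [Factors] The factor process satisfies $X_0\in\mathbb{R}^k$ and $X_{t+1}=G(X_t,W_t)$, where $G\colon\mathbb{R}^k\times\mathbb{R}^{k+m}\to\mathbb{R}^k$ is Borel measurable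 and continuous in the first variable. [Portfolio] For each $H\in\mathcal{A}$ the portfolio value process satisfies $V_0^H=V_0>0$ and $\ln(V_{t+1}^H/V_t^H)=F(X_t,H_t,W_t)$, where $F\colon\mathbb{R}^k\times U\times\mathbb{R}^{k+m}\to\mathbb{R}$ is Borel measurable and continuous with respect to the first two variables. [Growth] There are Borel functions $a_1,a_2\colon\mathbb{R}^{k+m}\to\mathbb{R}_+$, constants $b_1\in(0,1)$, $b_2>0$ and a continuous function $\omega\colon\mathbb{R}^k\to[0,\infty)$ (the weight function) such that $\omega(G(x,w))\le a_1(w)+b_1\omega(x)$ and $|F(x,h,w)|\le a_2(w)+b_2\omega(x)$ for all $x\in\mathbb{R}^k$, $h\in U$, $w\in\mathbb{R}^{k+m}$; moreover $\mu^{\gamma}(a_1(W_0))$ and $\mu^{\gamma}(a_2(W_0))$ are finite for every $\gamma\in\mathbb{R}$, where $\mu^\gamma(Z)=\frac1\gamma\ln\mathbb{E}[e^{\gamma Z}]$ for $\gamma\ne0$ and $\mu^0(Z)=\mathbb{E}[Z]$. [Minorization] For every $R>0$ there exist a constant $c>0$ and a probability measure $\nu$ on $\mathbb{R}^k$ such that $\inf_{x:\,\omega(x)\le R}\mathbb{P}[G(x,W_0)\in A]\ge c\,\nu(A)$ for all $A\in\mathcal{B}(\mathbb{R}^k)$. $\mathcal{C}_\omega(\mathbb{R}^k)$ is the set of continuous $f\colon\mathbb{R}^k\to\mathbb{R}$ with $\|f\|_\omega:=\sup_x\frac{|f(x)|}{1+\omega(x)}<\infty$. *)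

theory Defs
  imports "HOL-Probability.Probability"
begin

text \<open>
  Sample points are written \<open>s\<close>; \<open>\<omega>\<close> is the weight function. The noise takes values in
  \<open>real ^ ('k + 'm)\<close>, whose dimension is the sum of those of the factor space \<open>real ^ 'k\<close> and
  the portfolio space \<open>real ^ 'm\<close>.
\<close>

text \<open>
  The full sigma-algebra is the one generated by the union of the filtration: the union itself is
  in general only an algebra.
\<close>

definition filtered_prob_space :: "'a measure \<Rightarrow> (nat \<Rightarrow> 'a measure) \<Rightarrow> bool" where
  "filtered_prob_space M \<FF> \<longleftrightarrow>
     prob_space M \<and> filtration (space M) \<FF> \<and>
     sets (\<FF> 0) = {{}, space M} \<and>
     sets M = sigma_sets (space M) (\<Union>t. sets (\<FF> t))"

definition strategies ::
  "(nat \<Rightarrow> 'a measure) \<Rightarrow> (real ^ 'm) set \<Rightarrow> (nat \<Rightarrow> 'a \<Rightarrow> real ^ 'm) set" where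
  "strategies \<FF> U =
     {H. \<forall>t. H t \<in> borel_measurable (\<FF> t) \<and> (\<forall>s\<in>space (\<FF> t). H t s \<in> U)}"

text \<open>
  Since \<open>W t\<close> is independent of \<open>\<FF> t\<close>, the sigma-algebra generated by \<open>W\<close> at time \<open>t\<close> involves
  only \<open>W 0, ..., W (t - 1)\<close>.
\<close>

definition noise ::
  "'a measure \<Rightarrow> (nat \<Rightarrow> 'a measure) \<Rightarrow> (nat \<Rightarrow> 'a \<Rightarrow> real ^ ('k::finite + 'm::finite)) \<Rightarrow> bool" where
  "noise M \<FF> W \<longleftrightarrow>
     prob_space.indep_vars M (\<lambda>_. borel) W UNIV \<and>
     (\<forall>t. distr M borel (W t) = distr M borel (W 0)) \<and>
     (\<forall>t. sets (\<FF> t) =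
        sigma_sets (space M) (\<Union>i<t. {W i -` B \<inter> space M | B. B \<in> sets borel})) \<and>
     (\<forall>t. prob_space.indep_set M (sets (\<FF> t)) {W t -` B \<inter> space M | B. B \<in> sets borel})"

definition factors ::
  "'a measure \<Rightarrow> (nat \<Rightarrow> 'a \<Rightarrow> real ^ ('k::finite + 'm::finite)) \<Rightarrow>
   (real ^ 'k \<Rightarrow> real ^ ('k + 'm) \<Rightarrow> real ^ 'k) \<Rightarrow> real ^ 'k \<Rightarrow> (nat \<Rightarrow> 'a \<Rightarrow> real ^ 'k) \<Rightarrow> bool" where
  "factors M W G x\<^sub>0 X \<longleftrightarrow>
     (\<lambda>(x, w). G x w) \<in> borel_measurable borel \<and>
     (\<forall>w. continuous_on UNIV (\<lambda>x. G x w)) \<and>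
     (\<forall>s\<in>space M. X 0 s = x\<^sub>0 \<and> (\<forall>t. X (Suc t) s = G (X t s) (W t s)))"

text \<open>
  The map \<open>F\<close> is only constrained on controls in \<open>U\<close>. Positivity of the portfolio value is
  implicit in taking the logarithm of its increments, and is stated because \<open>ln\<close> is total.
\<close>

definition portfolio ::
  "'a measure \<Rightarrow> (nat \<Rightarrow> 'a measure) \<Rightarrow> (real ^ 'm::finite) set \<Rightarrow>
   (nat \<Rightarrow> 'a \<Rightarrow> real ^ ('k::finite + 'm)) \<Rightarrow> (nat \<Rightarrow> 'a \<Rightarrow> real ^ 'k) \<Rightarrow>
   (real ^ 'k \<Rightarrow> real ^ 'm \<Rightarrow> real ^ ('k + 'm) \<Rightarrow> real) \<Rightarrow>
   real \<Rightarrow> ((nat \<Rightarrow> 'a \<Rightarrow> real ^ 'm) \<Rightarrow> nat \<Rightarrow> 'a \<Rightarrow> real) \<Rightarrow> bool" where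
  "portfolio M \<FF> U W X F v\<^sub>0 V \<longleftrightarrow>
     (\<lambda>(x, h, w). F x h w) \<in> borel_measurable (restrict_space borel (UNIV \<times> U \<times> UNIV)) \<and>
     (\<forall>w. continuous_on (UNIV \<times> U) (\<lambda>(x, h). F x h w)) \<and>
     v\<^sub>0 > 0 \<and>
     (\<forall>H\<in>strategies \<FF> U. \<forall>s\<in>space M.
        V H 0 s = v\<^sub>0 \<and>
        (\<forall>t. V H t s > 0 \<and> ln (V H (Suc t) s / V H t s) = F (X t s) (H t s) (W t s)))"

definition ln_ennreal :: "ennreal \<Rightarrow> ereal" where
  "ln_ennreal z =
     (if z = 0 then - \<infinity> else if z = \<top> then \<infinity> else ereal (ln (enn2real z)))"

text \<open>
  The entropic utility, with extended real values so that its finiteness can be expressed.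
  The second branch is the extended expectation, positive part minus negative part.
\<close>

definition entropic_utility :: "'a measure \<Rightarrow> real \<Rightarrow> ('a \<Rightarrow> real) \<Rightarrow> ereal" where
  "entropic_utility M \<gamma> Z =
     (if \<gamma> \<noteq> 0 then ereal (1 / \<gamma>) * ln_ennreal (\<integral>\<^sup>+ s. ennreal (exp (\<gamma> * Z s)) \<partial>M)
      else enn2ereal (\<integral>\<^sup>+ s. ennreal (Z s) \<partial>M) - enn2ereal (\<integral>\<^sup>+ s. ennreal (- Z s) \<partial>M))"

definition growth ::
  "'a measure \<Rightarrow> (real ^ 'm::finite) set \<Rightarrow> (nat \<Rightarrow> 'a \<Rightarrow> real ^ ('k::finite + 'm)) \<Rightarrow>
   (real ^ 'k \<Rightarrow> real ^ ('k + 'm) \<Rightarrow> real ^ 'k) \<Rightarrow>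
   (real ^ 'k \<Rightarrow> real ^ 'm \<Rightarrow> real ^ ('k + 'm) \<Rightarrow> real) \<Rightarrow>
   (real ^ ('k + 'm) \<Rightarrow> real) \<Rightarrow> (real ^ ('k + 'm) \<Rightarrow> real) \<Rightarrow> real \<Rightarrow> real \<Rightarrow>
   (real ^ 'k \<Rightarrow> real) \<Rightarrow> bool" where
  "growth M U W G F a\<^sub>1 a\<^sub>2 b\<^sub>1 b\<^sub>2 \<omega> \<longleftrightarrow>
     a\<^sub>1 \<in> borel_measurable borel \<and> (\<forall>w. 0 \<le> a\<^sub>1 w) \<and>
     a\<^sub>2 \<in> borel_measurable borel \<and> (\<forall>w. 0 \<le> a\<^sub>2 w) \<and>
     0 < b\<^sub>1 \<and> b\<^sub>1 < 1 \<and> 0 < b\<^sub>2 \<and>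
     continuous_on UNIV \<omega> \<and> (\<forall>x. 0 \<le> \<omega> x) \<and>
     (\<forall>x w. \<omega> (G x w) \<le> a\<^sub>1 w + b\<^sub>1 * \<omega> x) \<and>
     (\<forall>x. \<forall>h\<in>U. \<forall>w. \<bar>F x h w\<bar> \<le> a\<^sub>2 w + b\<^sub>2 * \<omega> x) \<and>
     (\<forall>\<gamma>. \<bar>entropic_utility M \<gamma> (\<lambda>s. a\<^sub>1 (W 0 s))\<bar> \<noteq> \<infinity> \<and>
          \<bar>entropic_utility M \<gamma> (\<lambda>s. a\<^sub>2 (W 0 s))\<bar> \<noteq> \<infinity>)"

text \<open>The infimum is taken in \<open>ennreal\<close>, so over an empty sublevel set it is \<open>\<top>\<close>.\<close>

definition minorization ::
  "'a measure \<Rightarrow> (nat \<Rightarrow> 'a \<Rightarrow> real ^ ('k::finite + 'm::finite)) \<Rightarrow>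
   (real ^ 'k \<Rightarrow> real ^ ('k + 'm) \<Rightarrow> real ^ 'k) \<Rightarrow> (real ^ 'k \<Rightarrow> real) \<Rightarrow> bool" where
  "minorization M W G \<omega> \<longleftrightarrow>
     (\<forall>R>0. \<exists>c>0. \<exists>\<nu>. prob_space \<nu> \<and> sets \<nu> = sets borel \<and>
        (\<forall>A\<in>sets borel.
           (INF x\<in>{x. \<omega> x \<le> R}. emeasure M {s\<in>space M. G x (W 0 s) \<in> A})
             \<ge> ennreal c * emeasure \<nu> A))"

definition weighted_norm :: "('b \<Rightarrow> real) \<Rightarrow> ('b \<Rightarrow> real) \<Rightarrow> ereal" where
  "weighted_norm \<omega> f = (SUP x. ereal (\<bar>f x\<bar> / (1 + \<omega> x)))"

definition weighted_continuous :: "('b::topological_space \<Rightarrow> real) \<Rightarrow> ('b \<Rightarrow> real) set" where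
  "weighted_continuous \<omega> = {f. continuous_on UNIV f \<and> weighted_norm \<omega> f < \<infinity>}"

text \<open>
  The right-hand side is an extended real, so the equation also asserts that it is finite.
\<close>

definition solves_Bellman ::
  "'a measure \<Rightarrow> (real ^ 'm::finite) set \<Rightarrow> (nat \<Rightarrow> 'a \<Rightarrow> real ^ ('k::finite + 'm)) \<Rightarrow>
   (real ^ 'k \<Rightarrow> real ^ ('k + 'm) \<Rightarrow> real ^ 'k) \<Rightarrow>
   (real ^ 'k \<Rightarrow> real ^ 'm \<Rightarrow> real ^ ('k + 'm) \<Rightarrow> real) \<Rightarrow>
   real \<Rightarrow> (real ^ 'k \<Rightarrow> real) \<Rightarrow> real \<Rightarrow> bool" where
  "solves_Bellman M U W G F \<gamma> u lam \<longleftrightarrow>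
     (\<forall>x. ereal (u x + lam * \<gamma>) =
        (INF h\<in>U. ln_ennreal
           (\<integral>\<^sup>+ s. ennreal (exp (\<gamma> * F x h (W 0 s) + u (G x (W 0 s)))) \<partial>M)))"

end

theory Submission
  imports Defs
begin

text \<open>
  Write \<open>T\<close> for the operator on the right-hand side of the Bellman equation. By the Gibbs variational
  principle \<open>T f x - T g x\<close> is at most the mean of \<open>f - g\<close> under the exponentially tilted
  transition law of \<open>f\<close>. For \<open>f\<close> in a ball of \<open>C\<^sub>\<omega>\<close> these tilted laws satisfy a
  uniform drift condition for \<open>\<omega>\<close>, since all exponential moments of \<open>a\<^sub>1\<close> are finite, and a
  uniform overlap condition on sublevel sets of \<open>\<omega>\<close>, inherited from the minorization through the
  Cauchy--Schwarz inequality. The Hairer--Mattingly argument makes \<open>T\<close> a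
  contraction on every ball in a weighted oscillation seminorm, whence uniqueness for every
  \<open>\<gamma>\<close>. Small \<open>\<bar>\<gamma>\<bar>\<close> is only needed for the set of \<open>f\<close> with
  \<open>f x - f y \<le> 1 + K (\<omega> x + \<omega> y)\<close>, \<open>K\<close> proportional to \<open>\<bar>\<gamma>\<bar>\<close>, to be
  invariant; there the normalised iterates of \<open>T\<close> converge.
\<close>

section \<open>Exponential tilting and overlapping measures\<close>

text \<open>The operator commutes with adding constants, and the available bounds on the size of T f
  worsen by an additive constant with every application, so only differences f x - f y can be kept
  under control. The contraction rate depends on the ball. This does not hurt uniqueness, since two
  solutions lie in a common ball, but existence needs iterates that never leave one ball; this is
  why the invariant set is needed. Comparing T f with T g at two points x and y takes two controls,
  a minimiser for g at x and one for f at y. What remains is the single function f - g, integrated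
  against the tilt of f at x and against the tilt of g at y. These laws belong to different
  functions and different controls, so drift and overlap have to be uniform over the ball and over
  \<open>U\<close>.\<close>

lemma exists_const_abs_diff_le:
  fixes f p :: "'x \<Rightarrow> real"
  assumes "\<And>x y. f x - f y \<le> p x + p y"
  shows "\<exists>c. \<forall>x. \<bar>f x - c\<bar> \<le> p x"
proof -
  \<comment> \<open>Every number between the supremum of \<open>f - p\<close> and the infimum of
    \<open>f + p\<close> would do; the hypothesis says that the former is the smaller one. This
    turns an oscillation bound into a weighted sup bound.\<close>
  define c where "c = (SUP x. f x - p x)"
  have le: "f x - p x \<le> f y + p y" for x y
    using assms[of x y] by linarith
  have "f x - p x \<le> c" for x
    unfolding c_def by (rule cSUP_upper) (auto intro!: bdd_aboveI2[OF le])
  moreover have "c \<le> f y + p y" for y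
    unfolding c_def by (rule cSUP_least) (auto intro: le)
  ultimately show ?thesis
    by (intro exI[of _ c] allI) (smt (verit))
qed

text \<open>Convexity on the segment from 0 to \<open>z\<close>. It makes the errors for small risk
  aversion linear in \<bar>\<gamma>\<bar>, the exponents there being \<bar>\<gamma>\<bar> times a
  fixed variable.\<close>

lemma exp_scaled_le:
  fixes t z :: real
  assumes "0 \<le> t" "t \<le> 1"
  shows "exp (t * z) \<le> 1 + t * (exp z - 1)"
  using convex_onD[OF exp_convex, of t 0 z] assms by (auto simp: algebra_simps)

lemma abs_exp_diff_le:
  fixes u v s b :: real
  assumes "\<bar>u - v\<bar> \<le> s" "v \<le> b"
  shows "\<bar>exp u - exp v\<bar> \<le> exp b * (exp s - 1)"
proof -
  have s: "0 \<le> s" using assms by linarith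
  have eq: "exp u - exp v = exp v * (exp (u - v) - 1)"
    by (simp add: algebra_simps exp_diff)
  have "exp (u - v) - 1 \<le> exp s - 1"
    using assms by simp
  moreover have "1 - exp (u - v) \<le> exp s - 1"
  proof -
    have "exp (- s) \<le> exp (u - v)" using assms by simp
    moreover have "2 \<le> exp s + exp (- s)"
      using cosh_real_ge_1[of s] by (simp add: cosh_def)
    ultimately show ?thesis by linarith
  qed
  ultimately have "\<bar>exp (u - v) - 1\<bar> \<le> exp s - 1" by linarith
  then have "exp v * \<bar>exp (u - v) - 1\<bar> \<le> exp b * (exp s - 1)"
    using assms s by (intro mult_mono) auto
  then show ?thesis unfolding eq by (simp add: abs_mult)
qed

context prob_space
begin

lemma integral_exp_pos:
  assumes "integrable M (\<lambda>s. exp (Z s :: real))"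
  shows "0 < (\<integral>s. exp (Z s) \<partial>M)"
proof -
  have "(\<integral>s. exp (Z s) \<partial>M) \<noteq> 0"
    using integral_nonneg_eq_0_iff_AE[OF assms] AE_False by auto
  moreover have "0 \<le> (\<integral>s. exp (Z s) \<partial>M)" by simp
  ultimately show ?thesis by linarith
qed

text \<open>Cauchy--Schwarz for the factors sqrt \<psi> exp (Z / 2) and sqrt \<psi> exp (- Z / 2),
  where \<psi> \<le> 1 removes \<psi> from the second integral. A test function with mean bounded
  below therefore keeps a definite weight after an exponential change of measure.\<close>

lemma square_integral_le_exp_weighted:
  fixes \<psi> Z :: "'a \<Rightarrow> real"
  assumes [measurable]: "\<psi> \<in> borel_measurable M"
    and \<psi>: "\<And>s. 0 \<le> \<psi> s" "\<And>s. \<psi> s \<le> 1"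
    and Z: "integrable M (\<lambda>s. exp (Z s))" "integrable M (\<lambda>s. exp (- Z s))"
  shows "(\<integral>s. \<psi> s \<partial>M)\<^sup>2 \<le> (\<integral>s. \<psi> s * exp (Z s) \<partial>M) * (\<integral>s. exp (- Z s) \<partial>M)"
proof -
  define e where "e = (\<integral>s. \<psi> s \<partial>M)"
  define C where "C = (\<integral>s. exp (- Z s) \<partial>M)"
  have C: "0 < C" unfolding C_def by (rule integral_exp_pos[OF Z(2)])
  have [measurable]: "(\<lambda>s. exp (Z s)) \<in> borel_measurable M" using Z(1) by auto
  have i1: "integrable M \<psi>"
    by (rule integrable_const_bound[of _ 1]) (auto simp: \<psi>)
  have i2: "integrable M (\<lambda>s. \<psi> s * exp (Z s))"
    by (rule Bochner_Integration.integrable_bound[OF Z(1)])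
      (auto simp: \<psi> abs_mult mult_left_le_one_le)
  have e: "0 \<le> e" unfolding e_def using \<psi> by simp
  show ?thesis
  proof (cases "e = 0")
    case True
    then show ?thesis
      using \<psi> by (auto simp: e_def[symmetric] intro!: mult_nonneg_nonneg integral_nonneg)
  next
    case False
    with e have e: "0 < e" by simp
    \<comment> \<open>AM-GM with the optimal parameter \<open>C / e\<close>.\<close>
    have "2 * \<psi> s \<le> (C / e) * (\<psi> s * exp (Z s)) + (e / C) * exp (- Z s)" for s
    proof -
      define r where "r = C / e * exp (Z s)"
      have r: "0 < r" using C e by (simp add: r_def)
      have "2 \<le> r + 1 / r"
      proof -
        have "0 \<le> (r - 1)\<^sup>2 / r" using r by simp
        also have "(r - 1)\<^sup>2 / r = r + 1 / r - 2"
          using r by (simp add: power2_eq_square field_simps)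
        finally show ?thesis by simp
      qed
      then have "2 * \<psi> s \<le> \<psi> s * (r + 1 / r)"
        using \<psi>(1)[of s] by (metis mult.commute mult_left_mono)
      also have "\<dots> \<le> \<psi> s * r + 1 / r"
        using \<psi>(2)[of s] \<psi>(1)[of s] r
        by (simp add: distrib_left divide_right_mono)
      also have "\<dots> = (C / e) * (\<psi> s * exp (Z s)) + (e / C) * exp (- Z s)"
        using C e by (simp add: r_def exp_minus field_simps)
      finally show ?thesis .
    qed
    then have "(\<integral>s. 2 * \<psi> s \<partial>M) \<le> (\<integral>s. (C / e) * (\<psi> s * exp (Z s)) + (e / C) * exp (- Z s) \<partial>M)"
      by (intro integral_mono) (use i1 i2 Z in auto)
    then have "2 * e \<le> (C / e) * (\<integral>s. \<psi> s * exp (Z s) \<partial>M) + (e / C) * C"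
      using i2 Z by (simp add: e_def C_def)
    then have "e \<le> (C / e) * (\<integral>s. \<psi> s * exp (Z s) \<partial>M)" using C by simp
    then have "e * e \<le> C * (\<integral>s. \<psi> s * exp (Z s) \<partial>M)"
      using e by (simp add: field_simps)
    then show ?thesis by (simp add: e_def C_def power2_eq_square mult.commute)
  qed
qed

text \<open>The case \<psi> = 1. An upper bound on the integral of exp (- Z) thereby serves as a
  lower bound on that of exp Z.\<close>

lemma inverse_integral_exp_minus_le:
  fixes Z :: "'a \<Rightarrow> real"
  assumes "integrable M (\<lambda>s. exp (Z s))" "integrable M (\<lambda>s. exp (- Z s))"
  shows "1 / (\<integral>s. exp (- Z s) \<partial>M) \<le> (\<integral>s. exp (Z s) \<partial>M)"
  using square_integral_le_exp_weighted[of "\<lambda>_. 1" Z] assms integral_exp_pos[OF assms(2)]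
  by (simp add: prob_space field_simps)

text \<open>The inequality \<open>X \<le> exp (X - c) - 1 + c\<close>, applied with the optimal \<open>c\<close>.\<close>

lemma integral_exp_tilt_le:
  fixes X Z :: "'a \<Rightarrow> real"
  assumes Z: "integrable M (\<lambda>s. exp (Z s))" and XZ: "integrable M (\<lambda>s. exp (X s + Z s))"
    and X: "integrable M (\<lambda>s. X s * exp (Z s))"
  shows "(\<integral>s. X s * exp (Z s) \<partial>M) / (\<integral>s. exp (Z s) \<partial>M)
    \<le> ln (\<integral>s. exp (X s + Z s) \<partial>M) - ln (\<integral>s. exp (Z s) \<partial>M)"
proof -
  define I where "I = (\<integral>s. exp (Z s) \<partial>M)"
  define J where "J = (\<integral>s. exp (X s + Z s) \<partial>M)"
  have I: "0 < I" unfolding I_def by (rule integral_exp_pos[OF Z])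
  have J: "0 < J" unfolding J_def by (rule integral_exp_pos[OF XZ])
  define c where "c = ln J - ln I"
  have ec: "exp (- c) = I / J" using I J by (simp add: c_def exp_diff)
  have "X s * exp (Z s) \<le> exp (- c) * exp (X s + Z s) + (c - 1) * exp (Z s)" for s
  proof -
    have "X s \<le> exp (X s - c) - 1 + c" using exp_ge_add_one_self[of "X s - c"] by linarith
    then have "X s * exp (Z s) \<le> (exp (X s - c) - 1 + c) * exp (Z s)"
      by (intro mult_right_mono) auto
    also have "\<dots> = exp (- c) * exp (X s + Z s) + (c - 1) * exp (Z s)"
      by (simp add: exp_diff exp_add exp_minus field_simps)
    finally show ?thesis .
  qed
  then have "(\<integral>s. X s * exp (Z s) \<partial>M) \<le> (\<integral>s. exp (- c) * exp (X s + Z s) + (c - 1) * exp (Z s) \<partial>M)"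
    by (intro integral_mono) (use Z XZ X in auto)
  also have "\<dots> = exp (- c) * J + (c - 1) * I" using Z XZ by (simp add: I_def J_def)
  also have "\<dots> = c * I" using J by (simp add: ec algebra_simps)
  finally show ?thesis using I by (simp add: I_def[symmetric] J_def[symmetric] c_def field_simps)
qed

end

text \<open>
  The core of the Hairer--Mattingly argument. Far away the drift wins; on the sublevel set
  the function is split at height \<open>D\<close>, the bounded part being contracted by the overlap and
  the excess by the drift.
\<close>

lemma integral_diff_le_of_drift_overlap:
  fixes P Q :: "'x::topological_space measure" and \<phi> w :: "'x \<Rightarrow> real"
  assumes P: "prob_space P" "sets P = sets borel" and Q: "prob_space Q" "sets Q = sets borel"
    and \<phi>[measurable]: "\<phi> \<in> borel_measurable borel"
    and w: "integrable P w" "integrable Q w" "\<And>z. 0 \<le> w z"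
    and D: "0 < D" and bound: "\<And>z. \<bar>\<phi> z\<bar> \<le> D * (1 + \<beta> * w z)"
    and \<beta>: "0 < \<beta>" "2 * a * \<beta> \<le> \<alpha>"
    and b: "0 \<le> b" "b < 1" and R: "0 < R" "4 * a \<le> (1 - b) * R"
    and drift: "(\<integral>z. w z \<partial>P) \<le> b * v + a" "(\<integral>z. w z \<partial>Q) \<le> b * v' + a"
    and v: "0 \<le> v" "0 \<le> v'"
    and overlap: "\<And>\<psi>. \<lbrakk>v + v' < R; \<psi> \<in> borel_measurable borel; \<And>z. 0 \<le> \<psi> z; \<And>z. \<psi> z \<le> 1\<rbrakk> \<Longrightarrow>
      \<alpha> \<le> (\<integral>z. \<psi> z \<partial>P) + (\<integral>z. 1 - \<psi> z \<partial>Q)"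
  shows "(\<integral>z. \<phi> z \<partial>P) - (\<integral>z. \<phi> z \<partial>Q)
    \<le> max (max b (1 - \<alpha> / 2)) ((2 + \<beta> * R * ((1 + b) / 2)) / (2 + \<beta> * R)) * D * (2 + \<beta> * (v + v'))"
proof -
  interpret P: prob_space P by fact
  interpret Q: prob_space Q by fact
  have [measurable_cong]: "sets P = sets borel" "sets Q = sets borel" by fact+
  have [measurable]: "w \<in> borel_measurable borel"
    using w(1) P(2) by (metis borel_measurable_integrable measurable_cong_sets)
  have bound': "\<bar>\<phi> z\<bar> \<le> \<bar>D * (1 + \<beta> * w z)\<bar>" for z
    using bound[of z] by linarith
  have i: "integrable P \<phi>" "integrable Q \<phi>"
    by (rule Bochner_Integration.integrable_bound[where f = "\<lambda>z. D * (1 + \<beta> * w z)"],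
      use w bound' in simp_all)+
  define S where "S = v + v'"
  have S: "0 \<le> S" using v by (simp add: S_def)
  define q1 where "q1 = max b (1 - \<alpha> / 2)"
  define q2 where "q2 = (2 + \<beta> * R * ((1 + b) / 2)) / (2 + \<beta> * R)"
  have pos: "0 \<le> D * (2 + \<beta> * S)" using D \<beta> S by simp
  show ?thesis
  proof (cases "S < R")
    case False
    have "(\<integral>z. \<phi> z \<partial>P) \<le> (\<integral>z. D * (1 + \<beta> * w z) \<partial>P)"
      by (rule integral_mono) (use i w bound in \<open>auto simp: abs_le_iff\<close>)
    also have "\<dots> = D * (1 + \<beta> * (\<integral>z. w z \<partial>P))" using w by (simp add: P.prob_space)
    also have "\<dots> \<le> D * (1 + \<beta> * (b * v + a))" using D \<beta> drift by simp
    finally have 1: "(\<integral>z. \<phi> z \<partial>P) \<le> D * (1 + \<beta> * (b * v + a))" .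
    have "- (\<integral>z. \<phi> z \<partial>Q) = (\<integral>z. - \<phi> z \<partial>Q)" by simp
    also have "\<dots> \<le> (\<integral>z. D * (1 + \<beta> * w z) \<partial>Q)"
      by (rule integral_mono) (use i w bound in \<open>auto simp: abs_le_iff\<close>)
    also have "\<dots> = D * (1 + \<beta> * (\<integral>z. w z \<partial>Q))" using w by (simp add: Q.prob_space)
    also have "\<dots> \<le> D * (1 + \<beta> * (b * v' + a))" using D \<beta> drift by simp
    finally have "(\<integral>z. \<phi> z \<partial>P) - (\<integral>z. \<phi> z \<partial>Q) \<le> D * (2 + \<beta> * (b * S + 2 * a))"
      using 1 by (simp add: S_def algebra_simps)
    also have "\<dots> \<le> D * (2 + \<beta> * ((1 + b) / 2 * S))"
    proof -
      \<comment> \<open>Beyond \<open>R\<close> the drift constant costs 2 a \<le> (1 - b) S / 2,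
        half of the gap between \<open>b\<close> and 1.\<close>
      have "(1 - b) * R \<le> (1 - b) * S" using False b by (intro mult_left_mono) auto
      then have "b * S + 2 * a \<le> (1 + b) / 2 * S" using R by (simp add: algebra_simps)
      then show ?thesis using D \<beta> by simp
    qed
    \<comment> \<open>\<open>q2\<close> is the quotient of the two weights at S = R. The quotient
      decreases in \<open>S\<close>, so \<open>R\<close> is the worst case.\<close>
    also have "\<dots> \<le> D * (q2 * (2 + \<beta> * S))"
    proof -
      have "(2 + \<beta> * ((1 + b) / 2 * S)) * (2 + \<beta> * R) \<le> (2 + \<beta> * R * ((1 + b) / 2)) * (2 + \<beta> * S)"
      proof -
        have "\<beta> * ((1 - b) * R) \<le> \<beta> * ((1 - b) * S)"
          using False b \<beta> by (intro mult_left_mono) auto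
        moreover have "(2 + \<beta> * ((1 + b) / 2 * S)) * (2 + \<beta> * R)
            - (2 + \<beta> * R * ((1 + b) / 2)) * (2 + \<beta> * S) = \<beta> * ((1 - b) * R) - \<beta> * ((1 - b) * S)"
          by (simp add: field_simps)
        ultimately show ?thesis by (metis diff_le_0_iff_le)
      qed
      moreover have "0 < 2 + \<beta> * R" using \<beta> R by (simp add: add_pos_pos)
      ultimately have "2 + \<beta> * ((1 + b) / 2 * S) \<le> q2 * (2 + \<beta> * S)"
        unfolding q2_def by (simp add: pos_le_divide_eq)
      then show ?thesis using D by simp
    qed
    also have "\<dots> = q2 * (D * (2 + \<beta> * S))" by simp
    also have "\<dots> \<le> max q1 q2 * (D * (2 + \<beta> * S))" by (rule mult_right_mono) (use pos in auto)
    finally show ?thesis unfolding q1_def q2_def S_def by (simp add: mult.assoc)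
  next
    case True
    define \<phi>1 where "\<phi>1 z = max (- D) (min D (\<phi> z))" for z
    \<comment> \<open>Since \<psi> decreases in \<phi>, the overlap for \<psi> under
      \<open>P\<close> and 1 - \<psi> under \<open>Q\<close> bounds the difference of the integrals
      of \<open>\<phi>1\<close> from above.\<close>
    define \<psi> where "\<psi> z = (D - \<phi>1 z) / (2 * D)" for z
    have [measurable]: "\<phi>1 \<in> borel_measurable borel" "\<psi> \<in> borel_measurable borel"
      unfolding \<phi>1_def[abs_def] \<psi>_def[abs_def] by measurable
    have \<psi>: "0 \<le> \<psi> z" "\<psi> z \<le> 1" for z
      using D by (auto simp: \<psi>_def \<phi>1_def field_simps)
    have rest: "\<bar>\<phi> z - \<phi>1 z\<bar> \<le> D * \<beta> * w z" for z
    proof -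
      have "0 \<le> D * \<beta> * w z" using D \<beta> w(3) by simp
      moreover have "\<bar>\<phi> z\<bar> \<le> D + D * \<beta> * w z"
        using bound[of z] by (simp add: algebra_simps)
      ultimately show ?thesis using D unfolding \<phi>1_def by linarith
    qed
    have i\<psi>: "integrable P \<psi>" "integrable Q \<psi>"
      by (rule P.integrable_const_bound[of _ 1] Q.integrable_const_bound[of _ 1];
        use \<psi> in auto)+
    have \<phi>1: "\<phi>1 z = D - 2 * D * \<psi> z" for z using D by (simp add: \<psi>_def)
    have i1: "integrable P \<phi>1" "integrable Q \<phi>1"
      unfolding \<phi>1[abs_def] using i\<psi> by auto
    have "\<alpha> \<le> (\<integral>z. \<psi> z \<partial>P) + (\<integral>z. 1 - \<psi> z \<partial>Q)"
      by (rule overlap) (use True \<psi> in \<open>auto simp: S_def\<close>)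
    then have ov: "\<alpha> \<le> (\<integral>z. \<psi> z \<partial>P) + (1 - (\<integral>z. \<psi> z \<partial>Q))"
      using i\<psi> by (simp add: Q.prob_space)
    have "(\<integral>z. \<phi>1 z \<partial>P) - (\<integral>z. \<phi>1 z \<partial>Q) = 2 * D * ((\<integral>z. \<psi> z \<partial>Q) - (\<integral>z. \<psi> z \<partial>P))"
      unfolding \<phi>1 using i\<psi> by (simp add: P.prob_space Q.prob_space algebra_simps)
    also have "\<dots> \<le> 2 * D * (1 - \<alpha>)" using ov D by simp
    finally have 1: "(\<integral>z. \<phi>1 z \<partial>P) - (\<integral>z. \<phi>1 z \<partial>Q) \<le> 2 * D * (1 - \<alpha>)" .
    have "(\<integral>z. \<phi> z - \<phi>1 z \<partial>P) \<le> (\<integral>z. D * \<beta> * w z \<partial>P)"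
      by (rule integral_mono) (use i i1 w rest in \<open>auto simp: abs_le_iff\<close>)
    also have "\<dots> = D * \<beta> * (\<integral>z. w z \<partial>P)" using w by simp
    also have "\<dots> \<le> D * \<beta> * (b * v + a)" using D \<beta> drift by simp
    finally have 2: "(\<integral>z. \<phi> z \<partial>P) - (\<integral>z. \<phi>1 z \<partial>P) \<le> D * \<beta> * (b * v + a)" using i i1 by simp
    have "(\<integral>z. \<phi>1 z - \<phi> z \<partial>Q) \<le> (\<integral>z. D * \<beta> * w z \<partial>Q)"
      by (rule integral_mono) (use i i1 w rest in \<open>auto simp: abs_le_iff\<close>)
    also have "\<dots> = D * \<beta> * (\<integral>z. w z \<partial>Q)" using w by simp
    also have "\<dots> \<le> D * \<beta> * (b * v' + a)" using D \<beta> drift by simp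
    finally have "(\<integral>z. \<phi>1 z \<partial>Q) - (\<integral>z. \<phi> z \<partial>Q) \<le> D * \<beta> * (b * v' + a)" using i i1 by simp
    with 1 2 have "(\<integral>z. \<phi> z \<partial>P) - (\<integral>z. \<phi> z \<partial>Q) \<le> D * (2 - 2 * \<alpha> + 2 * a * \<beta> + b * \<beta> * S)"
      by (simp add: S_def algebra_simps)
    \<comment> \<open>The choice of \<beta> lets the drift constant consume at most half of the gain
      2 \<alpha> from the overlap.\<close>
    also have "\<dots> \<le> D * ((1 - \<alpha> / 2) * 2 + b * (\<beta> * S))"
      using D \<beta> by (intro mult_left_mono) (auto simp: algebra_simps)
    also have "\<dots> \<le> D * (q1 * 2 + q1 * (\<beta> * S))"
      using D \<beta> S by (intro mult_left_mono add_mono mult_right_mono) (auto simp: q1_def)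
    also have "\<dots> = q1 * (D * (2 + \<beta> * S))" by (simp add: algebra_simps)
    also have "\<dots> \<le> max q1 q2 * (D * (2 + \<beta> * S))" by (rule mult_right_mono) (use pos in auto)
    finally show ?thesis unfolding q1_def q2_def S_def by (simp add: mult.assoc)
  qed
qed

section \<open>The Bellman operator\<close>

text \<open>The Bellman equation involves only the law of one noise vector, so \<open>N\<close>
  lives on the noise space itself. The assumption \<open>overlap\<close> is minorization in the form
  in which it survives tilting: the infimum of the right-hand side over \<psi> is the mass shared by
  the transition laws from x and y.\<close>

locale controlled_factor = prob_space N
  for N :: "'w measure" +
  fixes U :: "'h::metric_space set"
    and G :: "'x::heine_borel \<Rightarrow> 'w \<Rightarrow> 'x"
    and F :: "'x \<Rightarrow> 'h \<Rightarrow> 'w \<Rightarrow> real"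
    and a1 a2 :: "'w \<Rightarrow> real" and b1 b2 :: real and \<omega> :: "'x \<Rightarrow> real"
  assumes U: "compact U" "U \<noteq> {}"
    and G_measurable: "\<And>x. G x \<in> N \<rightarrow>\<^sub>M borel"
    and F_measurable: "\<And>x h. h \<in> U \<Longrightarrow> F x h \<in> borel_measurable N"
    and G_continuous: "\<And>w. continuous_on UNIV (\<lambda>x. G x w)"
    and F_continuous: "\<And>w. continuous_on (UNIV \<times> U) (\<lambda>(x, h). F x h w)"
    and a_measurable [measurable]: "a1 \<in> borel_measurable N" "a2 \<in> borel_measurable N"
    and a_nonneg: "\<And>w. 0 \<le> a1 w" "\<And>w. 0 \<le> a2 w"
    and b: "0 < b1" "b1 < 1" "0 < b2"
    and \<omega>_continuous: "continuous_on UNIV \<omega>"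
    and \<omega>_nonneg: "\<And>x. 0 \<le> \<omega> x"
    and \<omega>_G_le: "\<And>x w. \<omega> (G x w) \<le> a1 w + b1 * \<omega> x"
    and abs_F_le: "\<And>x h w. h \<in> U \<Longrightarrow> \<bar>F x h w\<bar> \<le> a2 w + b2 * \<omega> x"
    and exp_moments: "\<And>\<theta>. integrable N (\<lambda>w. exp (\<theta> * a1 w))" "\<And>\<theta>. integrable N (\<lambda>w. exp (\<theta> * a2 w))"
    and overlap: "\<And>R. 0 < R \<Longrightarrow> \<exists>c>0. \<forall>x y. \<forall>\<psi>\<in>borel_measurable borel.
      \<omega> x \<le> R \<longrightarrow> \<omega> y \<le> R \<longrightarrow> (\<forall>z. 0 \<le> \<psi> z \<and> \<psi> z \<le> (1::real)) \<longrightarrow>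
      c \<le> (\<integral>w. \<psi> (G x w) \<partial>N) + (\<integral>w. 1 - \<psi> (G y w) \<partial>N)"
begin

text \<open>A ball of C\<omega> with slope and constant kept apart, because the operator acts
  differently on them: the slope goes to \<bar>\<gamma>\<bar> b2 + K b1, while the constant only
  accumulates.\<close>

definition admissible :: "real \<Rightarrow> real \<Rightarrow> ('x \<Rightarrow> real) \<Rightarrow> bool" where
  "admissible K D f \<longleftrightarrow> continuous_on UNIV f \<and> (\<forall>x. \<bar>f x\<bar> \<le> D + K * \<omega> x)"

definition exponent :: "real \<Rightarrow> ('x \<Rightarrow> real) \<Rightarrow> 'x \<Rightarrow> 'h \<Rightarrow> 'w \<Rightarrow> real" where
  "exponent \<gamma> f x h w = \<gamma> * F x h w + f (G x w)"

definition log_mgf :: "real \<Rightarrow> ('x \<Rightarrow> real) \<Rightarrow> 'x \<Rightarrow> 'h \<Rightarrow> real" where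
  "log_mgf \<gamma> f x h = ln (\<integral>w. exp (exponent \<gamma> f x h w) \<partial>N)"

definition Bellman :: "real \<Rightarrow> ('x \<Rightarrow> real) \<Rightarrow> 'x \<Rightarrow> real" where
  "Bellman \<gamma> f x = (INF h\<in>U. log_mgf \<gamma> f x h)"

definition mass :: "real \<Rightarrow> real \<Rightarrow> real" where
  "mass p q = (\<integral>w. exp (p * a1 w + q * a2 w) \<partial>N)"

definition tilt :: "real \<Rightarrow> ('x \<Rightarrow> real) \<Rightarrow> 'x \<Rightarrow> 'h \<Rightarrow> 'x measure" where
  "tilt \<gamma> f x h = distr (density N (\<lambda>w. ennreal (exp (exponent \<gamma> f x h w) /
     (\<integral>w. exp (exponent \<gamma> f x h w) \<partial>N)))) borel (G x)"

section \<open>Exponential moments and a priori bounds\<close>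

lemma \<omega>_measurable [measurable]: "\<omega> \<in> borel_measurable borel"
  using \<omega>_continuous by (rule borel_measurable_continuous_onI)

text \<open>Only separate exponential moments of \<open>a1\<close> and \<open>a2\<close> are given,
  and the two may be dependent; u v \<le> u^2 + v^2 reduces the joint moment to separate ones of
  doubled order.\<close>

lemma integrable_exp_combination:
  "integrable N (\<lambda>w. exp (p * a1 w + q * a2 w + r))"
proof (rule Bochner_Integration.integrable_bound)
  show "integrable N (\<lambda>w. exp r * (exp ((2 * p) * a1 w) + exp ((2 * q) * a2 w)))"
    using exp_moments by auto
  show "AE w in N. norm (exp (p * a1 w + q * a2 w + r))
      \<le> norm (exp r * (exp ((2 * p) * a1 w) + exp ((2 * q) * a2 w)))"
  proof (rule AE_I2)
    fix w
    define u v where "u = exp (p * a1 w)" and "v = exp (q * a2 w)"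
    have "u * v \<le> u\<^sup>2 + v\<^sup>2"
      using sum_squares_bound[of u v] zero_le_power2[of u] zero_le_power2[of v] by linarith
    moreover have "u\<^sup>2 = exp ((2 * p) * a1 w)" "v\<^sup>2 = exp ((2 * q) * a2 w)"
      by (simp_all add: u_def v_def power2_eq_square flip: exp_add)
    ultimately have "u * v * exp r \<le> (exp ((2 * p) * a1 w) + exp ((2 * q) * a2 w)) * exp r"
      by (intro mult_right_mono) auto
    then show "norm (exp (p * a1 w + q * a2 w + r))
      \<le> norm (exp r * (exp ((2 * p) * a1 w) + exp ((2 * q) * a2 w)))"
      by (simp add: u_def v_def exp_add mult.commute abs_of_nonneg)
  qed
qed measurable

lemma integrable_exp_combination':
  "integrable N (\<lambda>w. exp (p * a1 w + q * a2 w))"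
  using integrable_exp_combination[of p q 0] by simp

lemma integrable_exp_bounded:
  assumes "Y \<in> borel_measurable N" "\<And>w. \<bar>Y w\<bar> \<le> exp (p * a1 w + q * a2 w + r)"
  shows "integrable N Y"
  by (rule Bochner_Integration.integrable_bound[OF integrable_exp_combination[of p q r]])
    (use assms in auto)

lemma mass_pos: "0 < mass p q"
  unfolding mass_def by (rule integral_exp_pos) (rule integrable_exp_combination')

lemma mass_ge_1:
  assumes "0 \<le> p" "0 \<le> q" shows "1 \<le> mass p q"
proof -
  have "(\<integral>w. 1 \<partial>N) \<le> mass p q"
    unfolding mass_def
    by (rule integral_mono) (use assms a_nonneg integrable_exp_combination' in auto)
  then show ?thesis by (simp add: prob_space)
qed

lemma admissible_measurable: "admissible K D f \<Longrightarrow> f \<in> borel_measurable borel"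
  unfolding admissible_def by (auto intro: borel_measurable_continuous_onI)

lemma admissible_mono:
  assumes "admissible K D f" "K \<le> K'" "D \<le> D'" shows "admissible K' D' f"
proof -
  have "D + K * \<omega> x \<le> D' + K' * \<omega> x" for x
    using assms \<omega>_nonneg by (intro add_mono mult_right_mono)
  then show ?thesis using assms(1) unfolding admissible_def by (meson order_trans)
qed

lemma exponent_measurable:
  assumes "admissible K D f" "h \<in> U"
  shows "exponent \<gamma> f x h \<in> borel_measurable N"
proof -
  note [measurable] = admissible_measurable[OF assms(1)] F_measurable[OF assms(2)] G_measurable
  show ?thesis unfolding exponent_def[abs_def] by measurable
qed

lemma abs_f_G_le:
  assumes "admissible K D f" "0 \<le> K"
  shows "\<bar>f (G x w)\<bar> \<le> D + K * b1 * \<omega> x + K * a1 w"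
proof -
  have "K * \<omega> (G x w) \<le> K * (a1 w + b1 * \<omega> x)" using assms \<omega>_G_le by (intro mult_left_mono)
  moreover have "\<bar>f (G x w)\<bar> \<le> D + K * \<omega> (G x w)"
    using assms by (auto simp: admissible_def)
  ultimately show ?thesis by (simp add: algebra_simps)
qed

lemma abs_exponent_le:
  assumes "admissible K D f" "0 \<le> K" "h \<in> U"
  shows "\<bar>exponent \<gamma> f x h w\<bar> \<le> D + (\<bar>\<gamma>\<bar> * b2 + K * b1) * \<omega> x + (K * a1 w + \<bar>\<gamma>\<bar> * a2 w)"
proof -
  have "\<bar>\<gamma> * F x h w\<bar> \<le> \<bar>\<gamma>\<bar> * (a2 w + b2 * \<omega> x)"
    unfolding abs_mult using abs_F_le[OF assms(3)] by (intro mult_left_mono) auto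
  then show ?thesis
    using abs_f_G_le[OF assms(1,2), of x w] by (simp add: exponent_def algebra_simps)
qed

text \<open>One domination for all later integrands: \<open>Y\<close> is 1, an exponential of
  \<open>a1\<close>, \<open>a1\<close> itself or a function of \<open>G x\<close>, and
  \<open>s\<close> is 1 or -1.\<close>

lemma integrable_mult_exp_exponent:
  assumes f: "admissible K D f" "0 \<le> K" "h \<in> U"
    and Y: "Y \<in> borel_measurable N" "\<And>w. \<bar>Y w\<bar> \<le> C * exp (p * a1 w)" and s: "\<bar>s\<bar> \<le> 1"
  shows "integrable N (\<lambda>w. Y w * exp (s * exponent \<gamma> f x h w))"
proof (rule integrable_exp_bounded)
  note [measurable] = exponent_measurable[OF f(1,3)] Y(1)
  show "(\<lambda>w. Y w * exp (s * exponent \<gamma> f x h w)) \<in> borel_measurable N" by measurable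
  fix w
  have "s * exponent \<gamma> f x h w \<le> \<bar>exponent \<gamma> f x h w\<bar>"
    using s mult_left_le_one_le[of "\<bar>exponent \<gamma> f x h w\<bar>" "\<bar>s\<bar>"]
    by (simp add: abs_le_iff flip: abs_mult)
  then have "exp (s * exponent \<gamma> f x h w)
      \<le> exp (D + (\<bar>\<gamma>\<bar> * b2 + K * b1) * \<omega> x + (K * a1 w + \<bar>\<gamma>\<bar> * a2 w))"
    using abs_exponent_le[OF f, of \<gamma> x w] by simp
  moreover have "\<bar>Y w\<bar> \<le> exp (\<bar>C\<bar>) * exp (p * a1 w)"
  proof -
    have "C \<le> exp \<bar>C\<bar>" using exp_ge_add_one_self[of "\<bar>C\<bar>"] by linarith
    then show ?thesis using Y(2)[of w] by (meson exp_ge_zero mult_right_mono order_trans)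
  qed
  ultimately have "\<bar>Y w\<bar> * exp (s * exponent \<gamma> f x h w)
     \<le> exp \<bar>C\<bar> * exp (p * a1 w) * exp (D + (\<bar>\<gamma>\<bar> * b2 + K * b1) * \<omega> x + (K * a1 w + \<bar>\<gamma>\<bar> * a2 w))"
    by (intro mult_mono) auto
  then show "\<bar>Y w * exp (s * exponent \<gamma> f x h w)\<bar>
     \<le> exp ((p + K) * a1 w + \<bar>\<gamma>\<bar> * a2 w + (\<bar>C\<bar> + D + (\<bar>\<gamma>\<bar> * b2 + K * b1) * \<omega> x))"
    by (simp add: abs_mult algebra_simps flip: exp_add)
qed

lemma integrable_exp_exponent:
  assumes "admissible K D f" "0 \<le> K" "h \<in> U"
  shows "integrable N (\<lambda>w. exp (exponent \<gamma> f x h w))"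
    "integrable N (\<lambda>w. exp (- exponent \<gamma> f x h w))"
    "integrable N (\<lambda>w. exp (\<theta> * a1 w + exponent \<gamma> f x h w))"
  using integrable_mult_exp_exponent[OF assms, of "\<lambda>_. 1" 1 0 1 \<gamma> x]
    integrable_mult_exp_exponent[OF assms, of "\<lambda>_. 1" 1 0 "-1" \<gamma> x]
    integrable_mult_exp_exponent[OF assms, of "\<lambda>w. exp (\<theta> * a1 w)" 1 \<theta> 1 \<gamma> x]
  by (auto simp: exp_add)

lemma integral_exp_exponent_pos:
  assumes "admissible K D f" "0 \<le> K" "h \<in> U"
  shows "0 < (\<integral>w. exp (exponent \<gamma> f x h w) \<partial>N)"
  by (rule integral_exp_pos) (rule integrable_exp_exponent[OF assms])

lemma integral_exp_shift_exponent_le: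
  assumes f: "admissible K D f" "0 \<le> K" "h \<in> U"
  shows "(\<integral>w. exp (\<theta> * a1 w + exponent \<gamma> f x h w) \<partial>N)
      \<le> exp (D + (\<bar>\<gamma>\<bar> * b2 + K * b1) * \<omega> x) * mass (\<theta> + K) \<bar>\<gamma>\<bar>"
proof -
  have "exp (\<theta> * a1 w + exponent \<gamma> f x h w)
      \<le> exp (D + (\<bar>\<gamma>\<bar> * b2 + K * b1) * \<omega> x) * exp ((\<theta> + K) * a1 w + \<bar>\<gamma>\<bar> * a2 w)" for w
    using abs_exponent_le[OF f, of \<gamma> x w] by (simp add: algebra_simps flip: exp_add)
  then have "(\<integral>w. exp (\<theta> * a1 w + exponent \<gamma> f x h w) \<partial>N)
      \<le> (\<integral>w. exp (D + (\<bar>\<gamma>\<bar> * b2 + K * b1) * \<omega> x) * exp ((\<theta> + K) * a1 w + \<bar>\<gamma>\<bar> * a2 w) \<partial>N)"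
    by (intro integral_mono integrable_exp_exponent[OF f] integrable_mult_right
        integrable_exp_combination')
  then show ?thesis by (simp add: mass_def)
qed

lemma integral_exp_exponent_le:
  assumes f: "admissible K D f" "0 \<le> K" "h \<in> U"
  shows "(\<integral>w. exp (exponent \<gamma> f x h w) \<partial>N) \<le> exp (D + (\<bar>\<gamma>\<bar> * b2 + K * b1) * \<omega> x) * mass K \<bar>\<gamma>\<bar>"
    and "(\<integral>w. exp (- exponent \<gamma> f x h w) \<partial>N) \<le> exp (D + (\<bar>\<gamma>\<bar> * b2 + K * b1) * \<omega> x) * mass K \<bar>\<gamma>\<bar>"
proof -
  show "(\<integral>w. exp (exponent \<gamma> f x h w) \<partial>N) \<le> exp (D + (\<bar>\<gamma>\<bar> * b2 + K * b1) * \<omega> x) * mass K \<bar>\<gamma>\<bar>"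
    using integral_exp_shift_exponent_le[OF f, of 0 \<gamma> x] by simp
  have "exp (- exponent \<gamma> f x h w)
      \<le> exp (D + (\<bar>\<gamma>\<bar> * b2 + K * b1) * \<omega> x) * exp (K * a1 w + \<bar>\<gamma>\<bar> * a2 w)" for w
    using abs_exponent_le[OF f, of \<gamma> x w] by (simp add: algebra_simps flip: exp_add)
  then have "(\<integral>w. exp (- exponent \<gamma> f x h w) \<partial>N)
      \<le> (\<integral>w. exp (D + (\<bar>\<gamma>\<bar> * b2 + K * b1) * \<omega> x) * exp (K * a1 w + \<bar>\<gamma>\<bar> * a2 w) \<partial>N)"
    by (intro integral_mono integrable_exp_exponent[OF f] integrable_mult_right
        integrable_exp_combination')
  then show "(\<integral>w. exp (- exponent \<gamma> f x h w) \<partial>N) \<le> exp (D + (\<bar>\<gamma>\<bar> * b2 + K * b1) * \<omega> x) * mass K \<bar>\<gamma>\<bar>"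
    by (simp add: mass_def)
qed

text \<open>The same majorant bounds the integrals of exp Z and exp (- Z), and the latter gives the
  lower bound through \<open>inverse_integral_exp_minus_le\<close>. The term
  \<open>ln (mass K \<bar>\<gamma>\<bar>)\<close> is the constant added at each application.\<close>

lemma abs_log_mgf_le:
  assumes f: "admissible K D f" "0 \<le> K" "h \<in> U"
  shows "\<bar>log_mgf \<gamma> f x h\<bar> \<le> D + (\<bar>\<gamma>\<bar> * b2 + K * b1) * \<omega> x + ln (mass K \<bar>\<gamma>\<bar>)"
proof -
  define I J C where "I = (\<integral>w. exp (exponent \<gamma> f x h w) \<partial>N)"
    and "J = (\<integral>w. exp (- exponent \<gamma> f x h w) \<partial>N)"
    and "C = D + (\<bar>\<gamma>\<bar> * b2 + K * b1) * \<omega> x"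
  have I: "0 < I" unfolding I_def by (rule integral_exp_exponent_pos[OF f])
  have J: "0 < J" unfolding J_def by (rule integral_exp_pos) (rule integrable_exp_exponent[OF f])
  have m: "0 < mass K \<bar>\<gamma>\<bar>" by (rule mass_pos)
  have "ln I \<le> ln (exp C * mass K \<bar>\<gamma>\<bar>)" "ln J \<le> ln (exp C * mass K \<bar>\<gamma>\<bar>)"
    using integral_exp_exponent_le[OF f, of \<gamma> x] I J m by (auto simp: I_def J_def C_def)
  moreover have "ln (1 / J) \<le> ln I"
    using inverse_integral_exp_minus_le[OF integrable_exp_exponent(1,2)[OF f]] I J
    by (subst ln_le_cancel_iff) (auto simp: I_def J_def)
  ultimately show ?thesis
    using J m by (simp add: log_mgf_def I_def[symmetric] C_def[symmetric] ln_mult ln_div)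
qed

text \<open>Dominated convergence along sequences: \<omega> is bounded on a convergent sequence,
  which yields one integrable majorant for all its members. Continuity is joint so that compactness
  of \<open>U\<close> can be used below.\<close>

lemma continuous_on_log_mgf:
  assumes f: "admissible K D f" "0 \<le> K"
  shows "continuous_on (UNIV \<times> U) (\<lambda>(x, h). log_mgf \<gamma> f x h)"
proof -
  have "continuous_on (UNIV \<times> U) (\<lambda>(x, h). \<integral>w. exp (exponent \<gamma> f x h w) \<partial>N)"
  proof (rule continuous_on_sequentiallyI)
    fix u :: "nat \<Rightarrow> 'x \<times> 'h" and a :: "'x \<times> 'h"
    assume u: "\<forall>n. u n \<in> UNIV \<times> U" and a: "a \<in> UNIV \<times> U" and lim: "u \<longlonglongrightarrow> a"
    obtain x h where xh: "a = (x, h)" by fastforce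
    have h: "h \<in> U" using a xh by auto
    have uU: "snd (u n) \<in> U" for n using u by (auto simp: mem_Times_iff)
    have lim1: "(\<lambda>n. fst (u n)) \<longlonglongrightarrow> x" using tendsto_fst[OF lim] xh by simp
    have "(\<lambda>n. \<omega> (fst (u n))) \<longlonglongrightarrow> \<omega> x"
      using continuous_on_tendsto_compose[OF \<omega>_continuous lim1] by simp
    then have "Bseq (\<lambda>n. \<omega> (fst (u n)))" by (rule convergentI[THEN convergent_imp_Bseq])
    then obtain B where B: "\<And>n. \<omega> (fst (u n)) \<le> B"
      unfolding Bseq_def by (auto simp: abs_le_iff)
    have "(\<lambda>n. \<integral>w. exp (exponent \<gamma> f (fst (u n)) (snd (u n)) w) \<partial>N) \<longlonglongrightarrow> (\<integral>w. exp (exponent \<gamma> f x h w) \<partial>N)"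
    proof (rule integral_dominated_convergence)
      show "(\<lambda>w. exp (exponent \<gamma> f x h w)) \<in> borel_measurable N"
        using exponent_measurable[OF f(1) h] by measurable
      show "(\<lambda>w. exp (exponent \<gamma> f (fst (u n)) (snd (u n)) w)) \<in> borel_measurable N" for n
        using exponent_measurable[OF f(1) uU] by measurable
      show "integrable N (\<lambda>w. exp (K * a1 w + \<bar>\<gamma>\<bar> * a2 w + (D + (\<bar>\<gamma>\<bar> * b2 + K * b1) * B)))"
        by (rule integrable_exp_combination)
      show "AE w in N. (\<lambda>n. exp (exponent \<gamma> f (fst (u n)) (snd (u n)) w)) \<longlonglongrightarrow> exp (exponent \<gamma> f x h w)"
      proof (rule AE_I2)
        fix w
        have "(\<lambda>n. G (fst (u n)) w) \<longlonglongrightarrow> G x w"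
          using continuous_on_tendsto_compose[OF G_continuous lim1] by simp
        then have "(\<lambda>n. f (G (fst (u n)) w)) \<longlonglongrightarrow> f (G x w)"
          using f(1) continuous_on_tendsto_compose[of UNIV f] by (auto simp: admissible_def)
        moreover have "(\<lambda>n. F (fst (u n)) (snd (u n)) w) \<longlonglongrightarrow> F x h w"
          using continuous_on_tendsto_compose[OF F_continuous lim] u a xh
          by (simp add: case_prod_unfold)
        ultimately show "(\<lambda>n. exp (exponent \<gamma> f (fst (u n)) (snd (u n)) w)) \<longlonglongrightarrow> exp (exponent \<gamma> f x h w)"
          unfolding exponent_def by (intro tendsto_intros)
      qed
      show "AE w in N. norm (exp (exponent \<gamma> f (fst (u n)) (snd (u n)) w))
          \<le> exp (K * a1 w + \<bar>\<gamma>\<bar> * a2 w + (D + (\<bar>\<gamma>\<bar> * b2 + K * b1) * B))" for n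
      proof (rule AE_I2)
        fix w
        have "(\<bar>\<gamma>\<bar> * b2 + K * b1) * \<omega> (fst (u n)) \<le> (\<bar>\<gamma>\<bar> * b2 + K * b1) * B"
          using B f b by (intro mult_left_mono) auto
        then show "norm (exp (exponent \<gamma> f (fst (u n)) (snd (u n)) w))
          \<le> exp (K * a1 w + \<bar>\<gamma>\<bar> * a2 w + (D + (\<bar>\<gamma>\<bar> * b2 + K * b1) * B))"
          using abs_exponent_le[OF f uU[of n], of \<gamma> "fst (u n)" w] by simp
      qed
    qed
    then show "(\<lambda>n. case u n of (x, h) \<Rightarrow> \<integral>w. exp (exponent \<gamma> f x h w) \<partial>N)
        \<longlonglongrightarrow> (case a of (x, h) \<Rightarrow> \<integral>w. exp (exponent \<gamma> f x h w) \<partial>N)"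
      by (simp add: xh case_prod_unfold)
  qed
  then have "continuous_on (UNIV \<times> U) (\<lambda>z. ln (case z of (x, h) \<Rightarrow> \<integral>w. exp (exponent \<gamma> f x h w) \<partial>N))"
    by (rule continuous_on_ln) (use integral_exp_exponent_pos[OF f] in \<open>force simp: less_imp_neq[symmetric]\<close>)
  then show ?thesis by (simp add: log_mgf_def case_prod_unfold)
qed

text \<open>The infimum in \<open>Bellman\<close> is taken in the reals, so it is meaningful only
  once it is known to be a minimum. The minimisers also supply the controls at which two values are
  compared.\<close>

lemma Bellman_attained:
  assumes f: "admissible K D f" "0 \<le> K"
  obtains h where "h \<in> U" "Bellman \<gamma> f x = log_mgf \<gamma> f x h"
    "\<And>h'. h' \<in> U \<Longrightarrow> Bellman \<gamma> f x \<le> log_mgf \<gamma> f x h'"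
proof -
  have "continuous_on U (\<lambda>h. case (x, h) of (x, h) \<Rightarrow> log_mgf \<gamma> f x h)"
    by (rule continuous_on_compose2[OF continuous_on_log_mgf[OF f]]) (auto intro!: continuous_intros)
  then obtain h where h: "h \<in> U" "\<And>h'. h' \<in> U \<Longrightarrow> log_mgf \<gamma> f x h \<le> log_mgf \<gamma> f x h'"
    using continuous_attains_inf[OF U, of "log_mgf \<gamma> f x"] by auto
  have "Bellman \<gamma> f x = log_mgf \<gamma> f x h"
    unfolding Bellman_def by (rule cInf_eq_minimum) (use h in auto)
  then show ?thesis using h that by auto
qed

lemma Bellman_le: "\<lbrakk>admissible K D f; 0 \<le> K; h \<in> U\<rbrakk> \<Longrightarrow> Bellman \<gamma> f x \<le> log_mgf \<gamma> f x h"
  by (metis Bellman_attained)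

lemma continuous_on_Bellman:
  assumes f: "admissible K D f" "0 \<le> K"
  shows "continuous_on UNIV (Bellman \<gamma> f)"
proof (rule continuous_on_sequentiallyI)
  fix u :: "nat \<Rightarrow> 'x" and x assume lim: "u \<longlonglongrightarrow> x"
  \<comment> \<open>The sequence with its limit is compact, so on \<open>S \<times> U\<close>
    continuity is uniform: the functions of \<open>h\<close> at \<open>u n\<close> approach the one
    at \<open>x\<close> uniformly, and so do their minima.\<close>
  define S where "S = insert x (range u)"
  have "compact (S \<times> U)"
    unfolding S_def using lim U by (intro compact_Times compact_sequence_with_limit)
  then have unif: "uniformly_continuous_on (S \<times> U) (\<lambda>(x, h). log_mgf \<gamma> f x h)"
    by (intro compact_uniformly_continuous continuous_on_subset[OF continuous_on_log_mgf[OF f]]) auto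
  show "(\<lambda>n. Bellman \<gamma> f (u n)) \<longlonglongrightarrow> Bellman \<gamma> f x"
  proof (rule metric_LIMSEQ_I)
    fix e :: real assume e: "0 < e"
    obtain d where d: "0 < d" "\<And>z z'. \<lbrakk>z \<in> S \<times> U; z' \<in> S \<times> U; dist z' z < d\<rbrakk> \<Longrightarrow>
        dist (case z' of (x, h) \<Rightarrow> log_mgf \<gamma> f x h) (case z of (x, h) \<Rightarrow> log_mgf \<gamma> f x h) < e"
      using uniformly_continuous_onE[OF unif e] by metis
    obtain n0 where n0: "\<And>n. n \<ge> n0 \<Longrightarrow> dist (u n) x < d" using metric_LIMSEQ_D[OF lim d(1)] by auto
    have "dist (Bellman \<gamma> f (u n)) (Bellman \<gamma> f x) < e" if n: "n \<ge> n0" for n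
    proof -
      have near: "\<bar>log_mgf \<gamma> f (u n) h - log_mgf \<gamma> f x h\<bar> < e" if "h \<in> U" for h
        using d(2)[of "(x, h)" "(u n, h)"] n0[OF n] that
        by (auto simp: S_def dist_Pair_Pair dist_real_def)
      obtain h where h: "h \<in> U" "Bellman \<gamma> f x = log_mgf \<gamma> f x h"
        using Bellman_attained[OF f] by metis
      obtain h' where h': "h' \<in> U" "Bellman \<gamma> f (u n) = log_mgf \<gamma> f (u n) h'"
        using Bellman_attained[OF f] by metis
      show ?thesis
        using near[OF h(1)] near[OF h'(1)] Bellman_le[OF f h(1), of \<gamma> "u n"]
          Bellman_le[OF f h'(1), of \<gamma> x] h h' by (auto simp: dist_real_def)
    qed
    then show "\<exists>n0. \<forall>n\<ge>n0. dist (Bellman \<gamma> f (u n)) (Bellman \<gamma> f x) < e" by blast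
  qed
qed

section \<open>Contraction\<close>

lemma sets_tilt [simp, measurable_cong]: "sets (tilt \<gamma> f x h) = sets borel"
  by (simp add: tilt_def)

lemma prob_space_tilt:
  assumes f: "admissible K D f" "0 \<le> K" "h \<in> U"
  shows "prob_space (tilt \<gamma> f x h)"
proof -
  define I where "I = (\<integral>w. exp (exponent \<gamma> f x h w) \<partial>N)"
  have I: "0 < I" unfolding I_def by (rule integral_exp_exponent_pos[OF f])
  note [measurable] = exponent_measurable[OF f(1,3)]
  have "(\<integral>\<^sup>+w. ennreal (exp (exponent \<gamma> f x h w) / I) \<partial>N) = ennreal (\<integral>w. exp (exponent \<gamma> f x h w) / I \<partial>N)"
    using I by (intro nn_integral_eq_integral integrable_divide integrable_exp_exponent[OF f]) auto
  also have "\<dots> = 1" using I by (simp add: I_def)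
  finally have "prob_space (density N (\<lambda>w. ennreal (exp (exponent \<gamma> f x h w) / I)))"
    by (intro prob_spaceI) (simp add: emeasure_density)
  then show ?thesis
    unfolding tilt_def I_def[symmetric]
    by (rule prob_space.prob_space_distr) (use G_measurable in simp)
qed

lemma tilt_integral:
  assumes f: "admissible K D f" "0 \<le> K" "h \<in> U"
    and [measurable]: "(\<phi> :: 'x \<Rightarrow> real) \<in> borel_measurable borel"
  shows "integrable (tilt \<gamma> f x h) \<phi> \<longleftrightarrow> integrable N (\<lambda>w. \<phi> (G x w) * exp (exponent \<gamma> f x h w))"
    and "(\<integral>z. \<phi> z \<partial>tilt \<gamma> f x h)
      = (\<integral>w. \<phi> (G x w) * exp (exponent \<gamma> f x h w) \<partial>N) / (\<integral>w. exp (exponent \<gamma> f x h w) \<partial>N)"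
proof -
  define I where "I = (\<integral>w. exp (exponent \<gamma> f x h w) \<partial>N)"
  have I: "0 < I" unfolding I_def by (rule integral_exp_exponent_pos[OF f])
  note [measurable] = exponent_measurable[OF f(1,3)] G_measurable
  have eq: "(\<lambda>w. (exp (exponent \<gamma> f x h w) / I) *\<^sub>R \<phi> (G x w))
      = (\<lambda>w. \<phi> (G x w) * exp (exponent \<gamma> f x h w) / I)"
    by (simp add: fun_eq_iff)
  have "integrable (tilt \<gamma> f x h) \<phi> \<longleftrightarrow> integrable N (\<lambda>w. \<phi> (G x w) * exp (exponent \<gamma> f x h w) / I)"
    unfolding tilt_def I_def[symmetric] eq[symmetric] using I
    by (subst integrable_distr_eq, simp, simp, subst integrable_density) auto
  then show "integrable (tilt \<gamma> f x h) \<phi> \<longleftrightarrow> integrable N (\<lambda>w. \<phi> (G x w) * exp (exponent \<gamma> f x h w))"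
    using I by (simp only: divide_inverse integrable_mult_left_iff) simp
  show "(\<integral>z. \<phi> z \<partial>tilt \<gamma> f x h) = (\<integral>w. \<phi> (G x w) * exp (exponent \<gamma> f x h w) \<partial>N)
      / (\<integral>w. exp (exponent \<gamma> f x h w) \<partial>N)"
  proof -
    have "(\<integral>z. \<phi> z \<partial>tilt \<gamma> f x h) = (\<integral>w. \<phi> (G x w) * exp (exponent \<gamma> f x h w) / I \<partial>N)"
      unfolding tilt_def I_def[symmetric] eq[symmetric] using I
      by (subst integral_distr, simp, simp, subst integral_density) auto
    then show ?thesis by (simp add: I_def)
  qed
qed

lemma integrable_G_mult_exp_exponent:
  assumes f: "admissible K D f" "0 \<le> K" "h \<in> U"
    and [measurable]: "\<phi> \<in> borel_measurable borel" and \<phi>: "\<And>z. \<bar>\<phi> z\<bar> \<le> A + B * \<omega> z" and B: "0 \<le> B"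
  shows "integrable N (\<lambda>w. \<phi> (G x w) * exp (exponent \<gamma> f x h w))"
proof -
  note [measurable] = G_measurable
  have "\<bar>\<phi> (G x w)\<bar> \<le> (\<bar>A\<bar> + B * (1 + b1 * \<omega> x)) * exp (1 * a1 w)" for w
  proof -
    have "\<bar>\<phi> (G x w)\<bar> \<le> \<bar>A\<bar> + B * (a1 w + b1 * \<omega> x)"
      using \<phi>[of "G x w"] mult_left_mono[OF \<omega>_G_le[of x w] B] by linarith
    also have "\<dots> \<le> \<bar>A\<bar> * exp (a1 w) + B * (exp (a1 w) + b1 * \<omega> x * exp (a1 w))"
    proof -
      have 1: "1 \<le> exp (a1 w)" using a_nonneg by simp
      have "a1 w \<le> exp (a1 w)" using exp_ge_add_one_self[of "a1 w"] by linarith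
      moreover have "z \<le> z * exp (a1 w)" if "0 \<le> z" for z
        using mult_left_mono[OF 1 that] by simp
      ultimately show ?thesis
        using b B \<omega>_nonneg[of x] by (intro add_mono mult_left_mono) auto
    qed
    finally show ?thesis by (simp add: algebra_simps)
  qed
  from integrable_mult_exp_exponent[OF f _ this, of 1 \<gamma> x] show ?thesis by simp
qed

text \<open>The functional is convex in \<open>f\<close>, and its derivative at \<open>f\<close> is
  integration against the tilt of \<open>f\<close>; the value at \<open>g\<close> lies above this
  tangent. Hence the measure belongs to the function with the positive sign.\<close>

lemma log_mgf_diff_le:
  assumes f: "admissible K D f" and g: "admissible K D g" and K: "0 \<le> K" and h: "h \<in> U"
  shows "log_mgf \<gamma> f x h - log_mgf \<gamma> g x h \<le> (\<integral>z. f z - g z \<partial>tilt \<gamma> f x h)"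
proof -
  note [measurable] = admissible_measurable[OF f] admissible_measurable[OF g]
  have eq: "(g (G x w) - f (G x w)) + exponent \<gamma> f x h w = exponent \<gamma> g x h w" for w
    by (simp add: exponent_def)
  have "\<bar>g z - f z\<bar> \<le> 2 * D + 2 * K * \<omega> z" for z
  proof -
    have "\<bar>f z\<bar> \<le> D + K * \<omega> z" "\<bar>g z\<bar> \<le> D + K * \<omega> z"
      using f g by (auto simp: admissible_def)
    then show ?thesis by linarith
  qed
  then have i: "integrable N (\<lambda>w. (g (G x w) - f (G x w)) * exp (exponent \<gamma> f x h w))"
    using K by (intro integrable_G_mult_exp_exponent[OF f K h, of "\<lambda>z. g z - f z" "2 * D" "2 * K"]) auto
  have "(\<integral>z. g z - f z \<partial>tilt \<gamma> f x h) \<le> log_mgf \<gamma> g x h - log_mgf \<gamma> f x h"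
    using integral_exp_tilt_le[OF integrable_exp_exponent(1)[OF f K h] _ i]
      integrable_exp_exponent(1)[OF g K h]
    by (simp add: tilt_integral[OF f K h] eq log_mgf_def)
  moreover have "(\<integral>z. g z - f z \<partial>tilt \<gamma> f x h) = - (\<integral>z. f z - g z \<partial>tilt \<gamma> f x h)"
    by (simp flip: Bochner_Integration.integral_minus)
  ultimately show ?thesis by linarith
qed

text \<open>
  Changing measure by the tilt costs only a multiple of \<open>\<omega> x\<close>, which is made arbitrarily small
  by using a high exponential moment of \<open>a1\<close>.
\<close>

lemma tilt_drift:
  assumes K: "0 \<le> K"
  shows "\<exists>b a. 0 \<le> b \<and> b < 1 \<and> 0 \<le> a \<and> (\<forall>f x h. admissible K D f \<longrightarrow> h \<in> U \<longrightarrow>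
    integrable (tilt \<gamma> f x h) \<omega> \<and> (\<integral>z. \<omega> z \<partial>tilt \<gamma> f x h) \<le> b * \<omega> x + a)"
proof -
  define s where "s = \<bar>\<gamma>\<bar> * b2 + K * b1"
  have s: "0 \<le> s" unfolding s_def using K b by simp
  \<comment> \<open>Numerator and normalising integral each contribute s \<omega> x, and division by
    \<theta> turns the total 2 s into at most half of the gap 1 - b1. This explains the final rate
    (1 + b1) / 2.\<close>
  define \<theta> where "\<theta> = 1 + 4 * s / (1 - b1)"
  have \<theta>: "1 \<le> \<theta>" "2 * s / \<theta> \<le> (1 - b1) / 2"
  proof -
    have "0 \<le> 4 * s / (1 - b1)" using s b by simp
    then show "1 \<le> \<theta>" by (simp add: \<theta>_def)
    then have "0 < \<theta>" by simp
    moreover have "2 * s \<le> (1 - b1) / 2 * \<theta>" using b by (simp add: \<theta>_def distrib_left)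
    ultimately show "2 * s / \<theta> \<le> (1 - b1) / 2" by (simp add: pos_divide_le_eq)
  qed
  define a where "a = \<bar>(2 * D + ln (mass (\<theta> + K) \<bar>\<gamma>\<bar>) + ln (mass K \<bar>\<gamma>\<bar>)) / \<theta>\<bar>"
  have main: "integrable (tilt \<gamma> f x h) \<omega> \<and> (\<integral>z. \<omega> z \<partial>tilt \<gamma> f x h) \<le> (1 + b1) / 2 * \<omega> x + a"
    if f: "admissible K D f" and h: "h \<in> U" for f x h
  proof
    let ?E = "\<lambda>w. exp (exponent \<gamma> f x h w)"
    define I where "I = (\<integral>w. ?E w \<partial>N)"
    have I: "0 < I" unfolding I_def by (rule integral_exp_exponent_pos[OF f K h])
    have "integrable N (\<lambda>w. \<omega> (G x w) * ?E w)"
      by (rule integrable_G_mult_exp_exponent[OF f K h, of \<omega> 0 1]) (use \<omega>_nonneg in auto)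
    then show int: "integrable (tilt \<gamma> f x h) \<omega>"
      by (simp add: tilt_integral[OF f K h])
    have ia: "integrable N (\<lambda>w. a1 w * ?E w)"
    proof -
      have "\<bar>a1 w\<bar> \<le> 1 * exp (1 * a1 w)" for w
        using a_nonneg(1)[of w] exp_ge_add_one_self[of "a1 w"] by (simp del: exp_ge_add_one_self)
      from integrable_mult_exp_exponent[OF f K h a_measurable(1) this, of 1 \<gamma> x] show ?thesis by simp
    qed
    have "(\<integral>w. (\<theta> * a1 w) * ?E w \<partial>N) / I \<le> ln (\<integral>w. exp (\<theta> * a1 w + exponent \<gamma> f x h w) \<partial>N) - ln I"
      unfolding I_def using integrable_exp_exponent[OF f K h] ia
      by (intro integral_exp_tilt_le) (auto simp: mult.assoc)
    also have "\<dots> \<le> (D + s * \<omega> x + ln (mass (\<theta> + K) \<bar>\<gamma>\<bar>)) + (D + s * \<omega> x + ln (mass K \<bar>\<gamma>\<bar>))"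
    proof -
      have "0 < (\<integral>w. exp (\<theta> * a1 w + exponent \<gamma> f x h w) \<partial>N)"
        by (rule integral_exp_pos) (rule integrable_exp_exponent[OF f K h])
      then have "ln (\<integral>w. exp (\<theta> * a1 w + exponent \<gamma> f x h w) \<partial>N)
          \<le> ln (exp (D + s * \<omega> x) * mass (\<theta> + K) \<bar>\<gamma>\<bar>)"
        using integral_exp_shift_exponent_le[OF f K h, of \<theta> \<gamma> x] mass_pos[of "\<theta> + K" "\<bar>\<gamma>\<bar>"]
        by (simp add: s_def)
      then show ?thesis
        using abs_log_mgf_le[OF f K h, of \<gamma> x] mass_pos[of "\<theta> + K" "\<bar>\<gamma>\<bar>"]
        by (simp add: log_mgf_def I_def[symmetric] s_def[symmetric] ln_mult abs_le_iff)
    qed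
    finally have "\<theta> * ((\<integral>w. a1 w * ?E w \<partial>N) / I)
        \<le> 2 * s * \<omega> x + (2 * D + ln (mass (\<theta> + K) \<bar>\<gamma>\<bar>) + ln (mass K \<bar>\<gamma>\<bar>))"
      by (simp add: mult.assoc)
    then have "(\<integral>w. a1 w * ?E w \<partial>N) / I
        \<le> (2 * s * \<omega> x + (2 * D + ln (mass (\<theta> + K) \<bar>\<gamma>\<bar>) + ln (mass K \<bar>\<gamma>\<bar>))) / \<theta>"
      using \<theta> by (subst pos_le_divide_eq) (auto simp: mult.commute)
    also have "\<dots> \<le> (1 - b1) / 2 * \<omega> x + a"
      using mult_right_mono[OF \<theta>(2) \<omega>_nonneg[of x]] abs_ge_self
      by (simp add: a_def add_divide_distrib)
    finally have 1: "(\<integral>w. a1 w * ?E w \<partial>N) / I \<le> (1 - b1) / 2 * \<omega> x + a" .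
    have "(\<integral>w. \<omega> (G x w) * ?E w \<partial>N) \<le> (\<integral>w. a1 w * ?E w + b1 * \<omega> x * ?E w \<partial>N)"
    proof (rule integral_mono)
      show "integrable N (\<lambda>w. \<omega> (G x w) * ?E w)" by fact
      show "integrable N (\<lambda>w. a1 w * ?E w + b1 * \<omega> x * ?E w)"
        using ia integrable_exp_exponent(1)[OF f K h] by simp
      show "\<omega> (G x w) * ?E w \<le> a1 w * ?E w + b1 * \<omega> x * ?E w" for w
        using mult_right_mono[OF \<omega>_G_le[of x w], of "?E w"] by (simp add: algebra_simps)
    qed
    also have "\<dots> = (\<integral>w. a1 w * ?E w \<partial>N) + b1 * \<omega> x * I"
      using ia integrable_exp_exponent(1)[OF f K h] by (simp add: I_def)
    finally have "(\<integral>z. \<omega> z \<partial>tilt \<gamma> f x h) \<le> (\<integral>w. a1 w * ?E w \<partial>N) / I + b1 * \<omega> x"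
      using I by (simp add: tilt_integral[OF f K h] I_def[symmetric] field_simps)
    with 1 show "(\<integral>z. \<omega> z \<partial>tilt \<gamma> f x h) \<le> (1 + b1) / 2 * \<omega> x + a"
      by (simp add: field_simps)
  qed
  show ?thesis
    by (rule exI[of _ "(1 + b1) / 2"], rule exI[of _ a]) (use b main in \<open>auto simp: a_def\<close>)
qed

text \<open>One of the two untilted means, of \<psi> from x or of 1 - \<psi> from y, is at least c /
  2. Cauchy--Schwarz preserves a part (c / 2)^2 / M^2 of it under the tilt, where \<open>M\<close>
  bounds the integrals of exp Z and exp (- Z) on the sublevel set; the other mean is merely
  nonnegative. The two tilts therefore need not be related.\<close>

lemma tilt_overlap:
  assumes K: "0 \<le> K" and R: "0 < R"
  shows "\<exists>\<alpha>>0. \<forall>f g x y h h'. \<forall>\<psi>\<in>borel_measurable borel.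
    admissible K D f \<longrightarrow> admissible K D g \<longrightarrow> h \<in> U \<longrightarrow> h' \<in> U \<longrightarrow> \<omega> x \<le> R \<longrightarrow> \<omega> y \<le> R \<longrightarrow>
    (\<forall>z. 0 \<le> \<psi> z \<and> \<psi> z \<le> (1::real)) \<longrightarrow>
    \<alpha> \<le> (\<integral>z. \<psi> z \<partial>tilt \<gamma> f x h) + (\<integral>z. 1 - \<psi> z \<partial>tilt \<gamma> g y h')"
proof -
  obtain c where c: "0 < c" and ov: "\<And>x y \<psi>. \<lbrakk>\<psi> \<in> borel_measurable borel; \<omega> x \<le> R; \<omega> y \<le> R;
      \<And>z. 0 \<le> \<psi> z \<and> \<psi> z \<le> (1::real)\<rbrakk> \<Longrightarrow> c \<le> (\<integral>w. \<psi> (G x w) \<partial>N) + (\<integral>w. 1 - \<psi> (G y w) \<partial>N)"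
    using overlap[OF R] by blast
  define M where "M = exp (D + (\<bar>\<gamma>\<bar> * b2 + K * b1) * R) * mass K \<bar>\<gamma>\<bar>"
  have M: "0 < M" using mass_pos by (simp add: M_def)
  define \<alpha> where "\<alpha> = (c / 2)\<^sup>2 / (M * M)"
  have \<alpha>: "0 < \<alpha>" using c M by (simp add: \<alpha>_def)
  have half: "\<alpha> \<le> (\<integral>z. \<psi> z \<partial>tilt \<gamma> f x h)"
    if f: "admissible K D f" and h: "h \<in> U" and x: "\<omega> x \<le> R"
      and [measurable]: "\<psi> \<in> borel_measurable borel" and \<psi>: "\<And>z. 0 \<le> \<psi> z \<and> \<psi> z \<le> (1::real)"
      and c2: "c / 2 \<le> (\<integral>w. \<psi> (G x w) \<partial>N)"
    for f x h \<psi>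
  proof -
    note [measurable] = G_measurable
    let ?Z = "exponent \<gamma> f x h"
    have le: "exp (D + (\<bar>\<gamma>\<bar> * b2 + K * b1) * \<omega> x) * mass K \<bar>\<gamma>\<bar> \<le> M"
    proof -
      have "(\<bar>\<gamma>\<bar> * b2 + K * b1) * \<omega> x \<le> (\<bar>\<gamma>\<bar> * b2 + K * b1) * R"
        using x K b by (intro mult_left_mono) auto
      then show ?thesis using mass_pos[of K "\<bar>\<gamma>\<bar>"] by (simp add: M_def)
    qed
    have I: "0 < (\<integral>w. exp (?Z w) \<partial>N)" by (rule integral_exp_exponent_pos[OF f K h])
    have nn: "0 \<le> (\<integral>w. \<psi> (G x w) * exp (?Z w) \<partial>N)" using \<psi> by simp
    have "(c / 2)\<^sup>2 \<le> (\<integral>w. \<psi> (G x w) \<partial>N)\<^sup>2" using c c2 by (intro power_mono) auto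
    also have "\<dots> \<le> (\<integral>w. \<psi> (G x w) * exp (?Z w) \<partial>N) * (\<integral>w. exp (- ?Z w) \<partial>N)"
      by (rule square_integral_le_exp_weighted)
        (use \<psi> integrable_exp_exponent[OF f K h] in auto)
    also have "\<dots> \<le> (\<integral>w. \<psi> (G x w) * exp (?Z w) \<partial>N) * M"
      using integral_exp_exponent_le(2)[OF f K h, of \<gamma> x] le nn by (intro mult_left_mono) auto
    finally have "(c / 2)\<^sup>2 / M \<le> (\<integral>w. \<psi> (G x w) * exp (?Z w) \<partial>N)"
      using M by (simp add: pos_divide_le_eq)
    then have "(c / 2)\<^sup>2 / M / M \<le> (\<integral>w. \<psi> (G x w) * exp (?Z w) \<partial>N) / (\<integral>w. exp (?Z w) \<partial>N)"
      using integral_exp_exponent_le(1)[OF f K h, of \<gamma> x] le nn I M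
      by (intro frac_le) auto
    then show ?thesis by (simp add: \<alpha>_def tilt_integral[OF f K h])
  qed
  have "\<alpha> \<le> (\<integral>z. \<psi> z \<partial>tilt \<gamma> f x h) + (\<integral>z. 1 - \<psi> z \<partial>tilt \<gamma> g y h')"
    if f: "admissible K D f" and g: "admissible K D g" and h: "h \<in> U" "h' \<in> U"
      and xy: "\<omega> x \<le> R" "\<omega> y \<le> R"
      and m[measurable]: "\<psi> \<in> borel_measurable borel" and \<psi>: "\<And>z. 0 \<le> \<psi> z \<and> \<psi> z \<le> (1::real)"
    for f g x y h h' \<psi>
  proof -
    have m': "(\<lambda>z. 1 - \<psi> z) \<in> borel_measurable borel" by measurable
    have \<psi>': "0 \<le> 1 - \<psi> z \<and> 1 - \<psi> z \<le> 1" for z using \<psi>[of z] by simp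
    have nn: "0 \<le> (\<integral>z. \<psi> z \<partial>tilt \<gamma> f x h)" "0 \<le> (\<integral>z. 1 - \<psi> z \<partial>tilt \<gamma> g y h')"
      using \<psi> \<psi>' by (auto intro!: Bochner_Integration.integral_nonneg)
    have "c / 2 \<le> (\<integral>w. \<psi> (G x w) \<partial>N) \<or> c / 2 \<le> (\<integral>w. 1 - \<psi> (G y w) \<partial>N)"
      using ov[OF m xy \<psi>] by argo
    then show ?thesis
      using half[OF f h(1) xy(1) m \<psi>] half[OF g h(2) xy(2) m' \<psi>'] nn by auto
  qed
  then show ?thesis using \<alpha> by blast
qed

text \<open>The least \<open>C\<close> is the weighted oscillation seminorm of f - g, expressed
  through its upper bounds instead of a supremum. Exchanging x and y gives the absolute
  value.\<close>

definition contracts :: "real \<Rightarrow> real \<Rightarrow> real \<Rightarrow> real \<Rightarrow> real \<Rightarrow> bool" where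
  "contracts \<gamma> K D \<beta> q \<longleftrightarrow> (\<forall>f g C x y. admissible K D f \<longrightarrow> admissible K D g \<longrightarrow> 0 < C \<longrightarrow>
    (\<forall>x y. (f x - g x) - (f y - g y) \<le> C * (2 + \<beta> * (\<omega> x + \<omega> y))) \<longrightarrow>
    (Bellman \<gamma> f x - Bellman \<gamma> g x) - (Bellman \<gamma> f y - Bellman \<gamma> g y)
      \<le> q * C * (2 + \<beta> * (\<omega> x + \<omega> y)))"

lemma contractsD:
  assumes "contracts \<gamma> K D \<beta> q" "admissible K D f" "admissible K D g" "0 < C"
    and "\<And>x y. (f x - g x) - (f y - g y) \<le> C * (2 + \<beta> * (\<omega> x + \<omega> y))"
  shows "(Bellman \<gamma> f x - Bellman \<gamma> g x) - (Bellman \<gamma> f y - Bellman \<gamma> g y)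
      \<le> q * C * (2 + \<beta> * (\<omega> x + \<omega> y))"
  using assms(1)[unfolded contracts_def, rule_format, OF assms(2-4)] assms(5) by simp

text \<open>Evaluating both operators at the minimiser of the subtracted one, \<open>g\<close> at x
  and \<open>f\<close> at y, leaves two integrals of f - g under tilted laws. Both laws obey the
  same drift and overlap constants, so the estimate for a pair of measures applies.\<close>

lemma Bellman_contraction:
  assumes K: "0 \<le> K"
  obtains \<beta> q where "0 < \<beta>" "0 < q" "q < 1" "contracts \<gamma> K D \<beta> q"
proof -
  obtain b a where b: "0 \<le> b" "b < 1" and a: "0 \<le> a"
    and drift: "\<And>f x h. \<lbrakk>admissible K D f; h \<in> U\<rbrakk> \<Longrightarrow> integrable (tilt \<gamma> f x h) \<omega>"
      "\<And>f x h. \<lbrakk>admissible K D f; h \<in> U\<rbrakk> \<Longrightarrow> (\<integral>z. \<omega> z \<partial>tilt \<gamma> f x h) \<le> b * \<omega> x + a"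
    using tilt_drift[OF K, of D \<gamma>] by blast
  \<comment> \<open>The summand 1 keeps \<open>R\<close> positive when a = 0.\<close>
  define R where "R = 4 * a / (1 - b) + 1"
  have R: "0 < R" "4 * a \<le> (1 - b) * R"
  proof -
    have "0 \<le> 4 * a / (1 - b)" using a b by simp
    then show "0 < R" by (simp add: R_def)
    show "4 * a \<le> (1 - b) * R" using b by (simp add: R_def distrib_left)
  qed
  obtain \<alpha> where \<alpha>: "0 < \<alpha>" and ov: "\<And>f g x y h h' \<psi>. \<lbrakk>\<psi> \<in> borel_measurable borel;
      admissible K D f; admissible K D g; h \<in> U; h' \<in> U; \<omega> x \<le> R; \<omega> y \<le> R;
      \<And>z. 0 \<le> \<psi> z \<and> \<psi> z \<le> (1::real)\<rbrakk> \<Longrightarrow>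
      \<alpha> \<le> (\<integral>z. \<psi> z \<partial>tilt \<gamma> f x h) + (\<integral>z. 1 - \<psi> z \<partial>tilt \<gamma> g y h')"
    using tilt_overlap[OF K R(1), of D \<gamma>] by blast
  \<comment> \<open>The largest useful value is \<alpha> / (2 a); \<open>a + 1\<close> avoids
    division by zero.\<close>
  define \<beta> where "\<beta> = \<alpha> / (2 * (a + 1))"
  have \<beta>: "0 < \<beta>" "2 * a * \<beta> \<le> \<alpha>" using \<alpha> a by (auto simp: \<beta>_def field_simps)
  define q where "q = max (max b (1 - \<alpha> / 2)) ((2 + \<beta> * R * ((1 + b) / 2)) / (2 + \<beta> * R))"
  have q: "0 < q" using b \<beta> R by (auto simp: q_def less_max_iff_disj intro!: divide_pos_pos add_pos_pos)
  have q1: "q < 1"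
  proof -
    have "0 < \<beta> * R" using \<beta> R by simp
    moreover from this have "\<beta> * R * ((1 + b) / 2) < \<beta> * R * 1"
      using b by (intro mult_strict_left_mono) auto
    ultimately have "(2 + \<beta> * R * ((1 + b) / 2)) / (2 + \<beta> * R) < 1" by simp
    then show ?thesis using b \<alpha> by (simp add: q_def)
  qed
  have "(Bellman \<gamma> f x - Bellman \<gamma> g x) - (Bellman \<gamma> f y - Bellman \<gamma> g y)
      \<le> q * C * (2 + \<beta> * (\<omega> x + \<omega> y))"
    if f: "admissible K D f" and g: "admissible K D g" and C: "0 < C"
      and fg: "\<And>x y. (f x - g x) - (f y - g y) \<le> C * (2 + \<beta> * (\<omega> x + \<omega> y))"
    for f g C x y
  proof -
    note [measurable] = admissible_measurable[OF f] admissible_measurable[OF g]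
    \<comment> \<open>Both laws are probabilities, so subtracting \<open>d\<close> does not change
      the difference of the integrals, while f - g becomes bounded by the weight.\<close>
    obtain d where d: "\<And>z. \<bar>(f z - g z) - d\<bar> \<le> C * (1 + \<beta> * \<omega> z)"
      using exists_const_abs_diff_le[of "\<lambda>z. f z - g z" "\<lambda>z. C * (1 + \<beta> * \<omega> z)"] fg
      by (auto simp: algebra_simps)
    obtain h where h: "h \<in> U" "Bellman \<gamma> g x = log_mgf \<gamma> g x h" using Bellman_attained[OF g K] by metis
    obtain h' where h': "h' \<in> U" "Bellman \<gamma> f y = log_mgf \<gamma> f y h'" using Bellman_attained[OF f K] by metis
    let ?P = "tilt \<gamma> f x h" and ?Q = "tilt \<gamma> g y h'"
    interpret P: prob_space ?P by (rule prob_space_tilt[OF f K h(1)])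
    interpret Q: prob_space ?Q by (rule prob_space_tilt[OF g K h'(1)])
    have bd: "\<bar>(f z - g z) - d\<bar> \<le> \<bar>C * (1 + \<beta> * \<omega> z)\<bar>" for z
      using d[of z] by linarith
    have "integrable ?P (\<lambda>z. (f z - g z) - d)"
      by (rule Bochner_Integration.integrable_bound[where f = "\<lambda>z. C * (1 + \<beta> * \<omega> z)"])
        (use drift(1)[OF f h(1)] bd in auto)
    then have iP: "integrable ?P (\<lambda>z. f z - g z)"
      using Bochner_Integration.integrable_add[OF _ P.integrable_const[of d]] by fastforce
    have "integrable ?Q (\<lambda>z. (f z - g z) - d)"
      by (rule Bochner_Integration.integrable_bound[where f = "\<lambda>z. C * (1 + \<beta> * \<omega> z)"])
        (use drift(1)[OF g h'(1)] bd in auto)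
    then have iQ: "integrable ?Q (\<lambda>z. f z - g z)"
      using Bochner_Integration.integrable_add[OF _ Q.integrable_const[of d]] by fastforce
    have "Bellman \<gamma> f x - Bellman \<gamma> g x \<le> (\<integral>z. f z - g z \<partial>?P)"
      using log_mgf_diff_le[OF f g K h(1), of \<gamma> x] Bellman_le[OF f K h(1), of \<gamma> x] h by simp
    moreover have "Bellman \<gamma> g y - Bellman \<gamma> f y \<le> (\<integral>z. g z - f z \<partial>?Q)"
      using log_mgf_diff_le[OF g f K h'(1), of \<gamma> y] Bellman_le[OF g K h'(1), of \<gamma> y] h' by simp
    moreover have "(\<integral>z. g z - f z \<partial>?Q) = - (\<integral>z. f z - g z \<partial>?Q)"
      by (simp flip: Bochner_Integration.integral_minus)
    moreover have "(\<integral>z. f z - g z \<partial>?P) - (\<integral>z. f z - g z \<partial>?Q)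
        = (\<integral>z. (f z - g z) - d \<partial>?P) - (\<integral>z. (f z - g z) - d \<partial>?Q)"
      using iP iQ by (simp add: P.prob_space Q.prob_space)
    moreover have "\<dots> \<le> q * C * (2 + \<beta> * (\<omega> x + \<omega> y))"
      unfolding q_def
    proof (rule integral_diff_le_of_drift_overlap)
      show "prob_space ?P" "prob_space ?Q" by unfold_locales
      show "sets ?P = sets borel" "sets ?Q = sets borel" by simp_all
      show "(\<lambda>z. (f z - g z) - d) \<in> borel_measurable borel" by measurable
      show "integrable ?P \<omega>" "integrable ?Q \<omega>" using drift(1) f g h h' by auto
      show "(\<integral>z. \<omega> z \<partial>?P) \<le> b * \<omega> x + a" "(\<integral>z. \<omega> z \<partial>?Q) \<le> b * \<omega> y + a"
        using drift(2) f g h h' by auto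
      show "\<alpha> \<le> (\<integral>z. \<psi> z \<partial>?P) + (\<integral>z. 1 - \<psi> z \<partial>?Q)"
        if "\<omega> x + \<omega> y < R" "\<psi> \<in> borel_measurable borel" "\<And>z. 0 \<le> \<psi> z" "\<And>z. \<psi> z \<le> 1" for \<psi>
        using that \<omega>_nonneg[of x] \<omega>_nonneg[of y] by (intro ov[OF _ f g h(1) h'(1)]) auto
    qed (use C d \<beta> b R \<omega>_nonneg in auto)
    ultimately show ?thesis by linarith
  qed
  then have "contracts \<gamma> K D \<beta> q" unfolding contracts_def by simp
  then show ?thesis by (rule that[OF \<beta>(1) q q1])
qed

section \<open>An invariant set for small risk aversion\<close>

text \<open>The slope \<bar>\<gamma>\<bar> b2 / (1 - b1) would be exactly reproduced by the
  operator. Twice that value leaves a surplus of \<bar>\<gamma>\<bar> b2 at each application, which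
  pays for the additive constants.\<close>

definition \<kappa> :: real where
  "\<kappa> = 2 * b2 / (1 - b1)"

lemma \<kappa>: "0 < \<kappa>" "b2 + \<kappa> * b1 = \<kappa> - b2"
  using b by (auto simp: \<kappa>_def field_simps)

lemma integral_exp_scaled_le:
  assumes "0 \<le> t" "t \<le> 1"
  shows "(\<integral>w. exp (t * (p * a1 w + q * a2 w + r)) \<partial>N) \<le> 1 + t * (exp r * mass p q - 1)"
proof -
  have eq: "exp (p * a1 w + q * a2 w + r) = exp r * exp (p * a1 w + q * a2 w)" for w
    by (simp add: exp_add)
  have "(\<integral>w. exp (t * (p * a1 w + q * a2 w + r)) \<partial>N)
      \<le> (\<integral>w. 1 + t * (exp (p * a1 w + q * a2 w + r) - 1) \<partial>N)"
  proof (rule integral_mono)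
    show "integrable N (\<lambda>w. exp (t * (p * a1 w + q * a2 w + r)))"
      using integrable_exp_combination[of "t * p" "t * q" "t * r"] by (simp add: algebra_simps)
    show "integrable N (\<lambda>w. 1 + t * (exp (p * a1 w + q * a2 w + r) - 1))"
      using integrable_exp_combination[of p q r] by simp
  qed (rule exp_scaled_le[OF assms])
  also have "\<dots> = 1 + t * (exp r * mass p q - 1)"
    using integrable_exp_combination'[of p q] by (simp add: eq mass_def prob_space)
  finally show ?thesis .
qed

lemma log_mgf_shift:
  assumes f: "admissible K D f" "0 \<le> K" "h \<in> U"
  shows "log_mgf \<gamma> (\<lambda>z. f z - c) x h = log_mgf \<gamma> f x h - c"
proof -
  have "exp (exponent \<gamma> (\<lambda>z. f z - c) x h w) = exp (- c) * exp (exponent \<gamma> f x h w)" for w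
    by (simp add: exponent_def algebra_simps flip: exp_add)
  then have "(\<integral>w. exp (exponent \<gamma> (\<lambda>z. f z - c) x h w) \<partial>N)
      = exp (- c) * (\<integral>w. exp (exponent \<gamma> f x h w) \<partial>N)"
    by simp
  then show ?thesis
    using integral_exp_exponent_pos[OF f, of \<gamma> x] by (simp add: log_mgf_def ln_mult)
qed

text \<open>
  For large \<open>\<omega> x + \<omega> y\<close> the drift compensates the increments of the additive constant; otherwise,
  as \<open>\<gamma>\<close> tends to \<open>0\<close>, the operator approaches the factor dynamics
  acting on \<open>exp f\<close> with \<open>f\<close> clipped to an interval of length 1, which contracts the oscillation
  by the overlap.
\<close>

lemma Bellman_invariant:
  "\<exists>t>0. \<forall>\<gamma> f x y. \<bar>\<gamma>\<bar> < t \<longrightarrow> continuous_on UNIV f \<longrightarrow>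
    (\<forall>x y. f x - f y \<le> 1 + \<bar>\<gamma>\<bar> * \<kappa> * (\<omega> x + \<omega> y)) \<longrightarrow>
    Bellman \<gamma> f x - Bellman \<gamma> f y \<le> 1 + \<bar>\<gamma>\<bar> * \<kappa> * (\<omega> x + \<omega> y)"
proof -
  define m where "m = mass \<kappa> 1"
  have m: "1 \<le> m" unfolding m_def using \<kappa> by (intro mass_ge_1) auto
  \<comment> \<open>Each of the two points costs at most s (m - 1) through
    \<open>ln (mass K s)\<close>. Once \<omega> x + \<omega> y \<ge> R, the surplus slope s b2
    covers both.\<close>
  define R where "R = 2 * (m - 1) / b2 + 1"
  have R: "0 < R" "2 * (m - 1) \<le> b2 * R"
    using m b by (auto simp: R_def field_simps add_nonneg_pos)
  obtain c where c: "0 < c" and ov: "\<And>x y \<psi>. \<lbrakk>\<psi> \<in> borel_measurable borel; \<omega> x \<le> R; \<omega> y \<le> R;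
      \<And>z. 0 \<le> \<psi> z \<and> \<psi> z \<le> (1::real)\<rbrakk> \<Longrightarrow> c \<le> (\<integral>w. \<psi> (G x w) \<partial>N) + (\<integral>w. 1 - \<psi> (G y w) \<partial>N)"
    using overlap[OF R(1)] by blast
  \<comment> \<open>The extreme values of exp on the clipping interval [-1/2, 1/2]; their ratio exp
    1 corresponds to oscillation 1.\<close>
  define A B where "A = exp (- 1 / 2 :: real)" and "B = exp (1 / 2 :: real)"
  have AB: "0 < A" "A < B" "0 < B" "exp 1 * A = B"
    by (auto simp: A_def B_def simp flip: exp_add)
  define m' where "m' = exp (\<kappa> * R) * m"
  have m': "0 < m'" using m by (simp add: m'_def)
  \<comment> \<open>The approximation error s B m' occurs once at x and, multiplied by exp 1, once
    at y; their sum must not exceed the overlap gain (B - A) c. The bound 1 is for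
    \<open>exp_scaled_le\<close>.\<close>
  define t where "t = min 1 ((B - A) * c / ((1 + exp 1) * (B * m')))"
  have den: "0 < (1 + exp 1) * (B * m')" using AB m' by (simp add: add_pos_pos)
  have t: "0 < t" using AB c den by (simp add: t_def)
  have "Bellman \<gamma> f x - Bellman \<gamma> f y \<le> 1 + \<bar>\<gamma>\<bar> * \<kappa> * (\<omega> x + \<omega> y)"
    if g: "\<bar>\<gamma>\<bar> < t" and fc: "continuous_on UNIV f"
      and span: "\<And>x y. f x - f y \<le> 1 + \<bar>\<gamma>\<bar> * \<kappa> * (\<omega> x + \<omega> y)"
    for \<gamma> f x y
  proof -
    define s where "s = \<bar>\<gamma>\<bar>"
    define K where "K = s * \<kappa>"
    have s: "0 \<le> s" "s \<le> 1" "s * ((1 + exp 1) * (B * m')) \<le> (B - A) * c"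
      using g den by (auto simp: s_def t_def pos_less_divide_eq)
    have K: "0 \<le> K" unfolding K_def using s \<kappa> by simp
    have coef: "s * b2 + K * b1 = K - s * b2"
      using arg_cong[OF \<kappa>(2), of "\<lambda>u. s * u"] by (simp add: K_def algebra_simps)
    have span': "f x - f y \<le> (1 / 2 + K * \<omega> x) + (1 / 2 + K * \<omega> y)" for x y
      using span[of x y] by (simp add: K_def s_def algebra_simps)
    obtain d where d: "\<And>z. \<bar>f z - d\<bar> \<le> 1 / 2 + K * \<omega> z"
      using exists_const_abs_diff_le[of f "\<lambda>z. 1 / 2 + K * \<omega> z", OF span'] by auto
    define u where "u z = f z - d" for z
    have u: "admissible K (1 / 2) u"
      unfolding admissible_def u_def[abs_def] using d fc by (auto intro!: continuous_intros)
    have f: "admissible K (1 / 2 + \<bar>d\<bar>) f"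
      unfolding admissible_def using fc
    proof (intro conjI allI)
      fix z show "\<bar>f z\<bar> \<le> 1 / 2 + \<bar>d\<bar> + K * \<omega> z" using d[of z] by linarith
    qed
    obtain h where h: "h \<in> U" "Bellman \<gamma> f y = log_mgf \<gamma> f y h" using Bellman_attained[OF f K] by metis
    have diff: "Bellman \<gamma> f x - Bellman \<gamma> f y \<le> log_mgf \<gamma> u x h - log_mgf \<gamma> u y h"
      using Bellman_le[OF f K h(1), of \<gamma> x] h(2)
      by (simp add: u_def[abs_def] log_mgf_shift[OF f K h(1)])
    show ?thesis
    proof (cases "\<omega> x + \<omega> y < R")
      case False
      have "mass K s \<le> 1 + s * (m - 1)"
        using integral_exp_scaled_le[OF s(1,2), of \<kappa> 1 0]
        by (simp add: mass_def m_def K_def algebra_simps)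
      then have "ln (mass K s) \<le> s * (m - 1)"
        using ln_le_minus_one[OF mass_pos[of K s]] by linarith
      then have "log_mgf \<gamma> u x h - log_mgf \<gamma> u y h
          \<le> 1 + (K - s * b2) * (\<omega> x + \<omega> y) + 2 * (s * (m - 1))"
        using abs_log_mgf_le[OF u K h(1), of \<gamma> x] abs_log_mgf_le[OF u K h(1), of \<gamma> y]
        unfolding s_def[symmetric] coef by (simp add: abs_le_iff distrib_left)
      also have "\<dots> \<le> 1 + K * (\<omega> x + \<omega> y)"
      proof -
        have "b2 * R \<le> b2 * (\<omega> x + \<omega> y)" using False b by (intro mult_left_mono) auto
        then have "s * (2 * (m - 1)) \<le> s * (b2 * (\<omega> x + \<omega> y))"
          using R s by (intro mult_left_mono) auto
        then show ?thesis by (simp add: algebra_simps)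
      qed
      finally show ?thesis using diff by (simp add: K_def s_def)
    next
      case True
      define v where "v z = max (- 1 / 2) (min (1 / 2) (u z))" for z
      note [measurable] = admissible_measurable[OF u] G_measurable
      have v_meas[measurable]: "v \<in> borel_measurable borel" unfolding v_def[abs_def] by measurable
      have v: "- 1 / 2 \<le> v z" "v z \<le> 1 / 2" for z by (auto simp: v_def)
      have uv: "\<bar>u z - v z\<bar> \<le> K * \<omega> z" for z
      proof -
        have "0 \<le> K * \<omega> z" using K \<omega>_nonneg by simp
        then show ?thesis using d[of z] unfolding v_def u_def by linarith
      qed
      \<comment> \<open>The overlap speaks about test functions with values in [0, 1], so exp v is
        rescaled affinely.\<close>
      define \<psi> where "\<psi> z = (exp (v z) - A) / (B - A)" for z
      have [measurable]: "\<psi> \<in> borel_measurable borel" unfolding \<psi>_def[abs_def] by measurable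
      have \<psi>: "0 \<le> \<psi> z \<and> \<psi> z \<le> 1" for z
        using v[of z] AB by (auto simp: \<psi>_def A_def B_def field_simps)
      have i\<psi>: "integrable N (\<lambda>w. \<psi> (G x w))" for x
        by (rule integrable_const_bound[of _ 1]) (use \<psi> in auto)
      define p where "p x = (\<integral>w. \<psi> (G x w) \<partial>N)" for x
      have p0: "0 \<le> p x" for x unfolding p_def using \<psi> by simp
      have ev: "exp (v z) = A + (B - A) * \<psi> z" for z using AB by (simp add: \<psi>_def)
      have iv: "integrable N (\<lambda>w. exp (v (G x w)))" for x
        unfolding ev using i\<psi> by simp
      have Ev: "(\<integral>w. exp (v (G x w)) \<partial>N) = A + (B - A) * p x" for x
        unfolding ev p_def using i\<psi> by (simp add: prob_space)
      \<comment> \<open>Both sources of error, \<gamma> F and the clipping u - v, are at most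
        \<open>s\<close> times a fixed variable with exponential moments, so by convexity the
        integrals differ by O(s).\<close>
      have approx: "\<bar>(\<integral>w. exp (exponent \<gamma> u x h w) \<partial>N) - (A + (B - A) * p x)\<bar> \<le> s * (B * m')"
        if x: "\<omega> x \<le> R" for x
      proof -
        note iu = integrable_exp_exponent(1)[OF u K h(1), of \<gamma> x]
        have "\<bar>exp (exponent \<gamma> u x h w) - exp (v (G x w))\<bar>
            \<le> B * (exp (s * (\<kappa> * a1 w + 1 * a2 w + \<kappa> * R)) - 1)" for w
          unfolding B_def
        proof (rule abs_exp_diff_le[OF _ v(2)])
          have "\<bar>\<gamma> * F x h w\<bar> \<le> s * (a2 w + b2 * \<omega> x)"
            unfolding abs_mult s_def using abs_F_le[OF h(1)] by (intro mult_left_mono) auto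
          moreover have "\<bar>u (G x w) - v (G x w)\<bar> \<le> K * (a1 w + b1 * \<omega> x)"
            using uv[of "G x w"] mult_left_mono[OF \<omega>_G_le[of x w] K] by linarith
          ultimately have "\<bar>exponent \<gamma> u x h w - v (G x w)\<bar>
              \<le> s * a2 w + K * a1 w + (s * b2 + K * b1) * \<omega> x"
            by (simp add: exponent_def algebra_simps)
          also have "\<dots> \<le> s * a2 w + K * a1 w + K * R"
          proof -
            have "(s * b2 + K * b1) * \<omega> x \<le> K * R"
              unfolding coef using x s b K \<omega>_nonneg R coef
              by (intro mult_mono) (auto simp: mult_nonneg_nonneg)
            then show ?thesis by simp
          qed
          finally show "\<bar>exponent \<gamma> u x h w - v (G x w)\<bar> \<le> s * (\<kappa> * a1 w + 1 * a2 w + \<kappa> * R)"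
            by (simp add: K_def algebra_simps)
        qed
        moreover have ie: "integrable N (\<lambda>w. exp (s * (\<kappa> * a1 w + 1 * a2 w + \<kappa> * R)))"
          using integrable_exp_combination[of "s * \<kappa>" "s * 1" "s * (\<kappa> * R)"]
          by (simp add: algebra_simps)
        ultimately have "\<bar>\<integral>w. exp (exponent \<gamma> u x h w) - exp (v (G x w)) \<partial>N\<bar>
            \<le> (\<integral>w. B * (exp (s * (\<kappa> * a1 w + 1 * a2 w + \<kappa> * R)) - 1) \<partial>N)"
          using iu iv
          by (intro order_trans[OF integral_abs_bound] integral_mono) auto
        also have "\<dots> = B * ((\<integral>w. exp (s * (\<kappa> * a1 w + 1 * a2 w + \<kappa> * R)) \<partial>N) - 1)"
          using ie by (simp add: prob_space)
        also have "\<dots> \<le> B * (s * (m' - 1))"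
          using integral_exp_scaled_le[OF s(1,2), of \<kappa> 1 "\<kappa> * R"] AB
          by (intro mult_left_mono) (auto simp: m'_def m_def)
        also have "\<dots> \<le> s * (B * m')" using s AB by (simp add: algebra_simps)
        finally show ?thesis using iu iv by (simp add: Ev)
      qed
      have xy: "\<omega> x \<le> R" "\<omega> y \<le> R" using True \<omega>_nonneg[of x] \<omega>_nonneg[of y] by linarith+
      have "c \<le> p y + (1 - p x)"
        using ov[of \<psi> y x] xy \<psi> i\<psi> by (simp add: p_def prob_space)
      then have "(B - A) * (p x - p y) \<le> (B - A) * (1 - c)" using AB by (intro mult_left_mono) auto
      moreover have "(B - A) * p y \<le> exp 1 * ((B - A) * p y)"
        using AB p0[of y] mult_right_mono[of 1 "exp 1" "(B - A) * p y"] by simp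
      \<comment> \<open>By the overlap the left side is at most B + (B - A) p y, and B = exp 1 *
        A.\<close>
      ultimately have "A + (B - A) * p x + (B - A) * c \<le> exp 1 * (A + (B - A) * p y)"
        using AB(4) by (simp add: algebra_simps)
      moreover have "s * (B * m') + exp 1 * (s * (B * m')) \<le> (B - A) * c"
        using s(3) by (simp add: algebra_simps)
      ultimately have "A + (B - A) * p x + s * (B * m') \<le> exp 1 * (A + (B - A) * p y - s * (B * m'))"
        by (simp add: right_diff_distrib)
      also have "\<dots> \<le> exp 1 * (\<integral>w. exp (exponent \<gamma> u y h w) \<partial>N)"
        using approx[OF xy(2)] by (intro mult_left_mono) auto
      finally have le: "(\<integral>w. exp (exponent \<gamma> u x h w) \<partial>N) \<le> exp 1 * (\<integral>w. exp (exponent \<gamma> u y h w) \<partial>N)"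
        using approx[OF xy(1)] by linarith
      have "log_mgf \<gamma> u x h \<le> ln (exp 1 * (\<integral>w. exp (exponent \<gamma> u y h w) \<partial>N))"
        unfolding log_mgf_def using le integral_exp_exponent_pos[OF u K h(1)] by simp
      also have "\<dots> = 1 + log_mgf \<gamma> u y h"
        unfolding log_mgf_def using integral_exp_exponent_pos[OF u K h(1), of \<gamma> y]
        by (simp add: ln_mult)
      finally have "Bellman \<gamma> f x - Bellman \<gamma> f y \<le> 1" using diff by linarith
      moreover have "0 \<le> \<bar>\<gamma>\<bar> * \<kappa> * (\<omega> x + \<omega> y)" using \<kappa> \<omega>_nonneg by simp
      ultimately show ?thesis by linarith
    qed
  qed
  then show ?thesis using t by blast
qed

section \<open>Fixed points\<close>

text \<open>Picard iteration of the normalised operator. Invariance keeps every iterate in the ball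
  with constants \<open>K\<close> and \<open>D\<close>, so a single rate \<open>q\<close> governs
  all steps; as the iterates vanish at \<open>z\<close>, oscillation bounds become pointwise
  ones.\<close>

lemma Bellman_fixed_point:
  assumes K: "0 \<le> K"
    and invariant: "\<And>f x y. \<lbrakk>continuous_on UNIV f; \<And>x y. f x - f y \<le> 1 + K * (\<omega> x + \<omega> y)\<rbrakk> \<Longrightarrow>
      Bellman \<gamma> f x - Bellman \<gamma> f y \<le> 1 + K * (\<omega> x + \<omega> y)"
  shows "\<exists>u D c. admissible K D u \<and> (\<forall>x. Bellman \<gamma> u x = u x + c)"
proof -
  \<comment> \<open>An arbitrary reference point.\<close>
  define z :: 'x where "z = undefined"
  define D where "D = 1 + K * \<omega> z"
  obtain \<beta> q where \<beta>: "0 < \<beta>" and q: "0 < q" "q < 1"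
    and "contracts \<gamma> K D \<beta> q"
    using Bellman_contraction[OF K, of \<gamma> D] .
  note contr = contractsD[OF this(4)]
  define f where "f n = ((\<lambda>f x. Bellman \<gamma> f x - Bellman \<gamma> f z) ^^ n) (\<lambda>_. 0)" for n
  have f_Suc: "f (Suc n) x = Bellman \<gamma> (f n) x - Bellman \<gamma> (f n) z" for n x by (simp add: f_def)
  have adm: "admissible K D g"
    if "continuous_on UNIV g" "g z = 0" "\<And>x y. g x - g y \<le> 1 + K * (\<omega> x + \<omega> y)" for g
    unfolding admissible_def
  proof (intro conjI allI)
    fix x show "\<bar>g x\<bar> \<le> D + K * \<omega> x"
      using that(2) that(3)[of x z] that(3)[of z x] by (simp add: D_def algebra_simps abs_le_iff)
  qed (rule that)
  have f: "continuous_on UNIV (f n) \<and> f n z = 0 \<and> (\<forall>x y. f n x - f n y \<le> 1 + K * (\<omega> x + \<omega> y))" for n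
  proof (induction n)
    case 0
    show ?case using K \<omega>_nonneg by (simp add: f_def add_nonneg_nonneg)
  next
    case (Suc n)
    then have a: "admissible K D (f n)" by (intro adm) auto
    have "f (Suc n) = (\<lambda>x. Bellman \<gamma> (f n) x - Bellman \<gamma> (f n) z)" by (simp add: f_Suc fun_eq_iff)
    then have "continuous_on UNIV (f (Suc n))"
      using continuous_on_Bellman[OF a K] by (auto intro: continuous_intros)
    moreover have "f (Suc n) x - f (Suc n) y \<le> 1 + K * (\<omega> x + \<omega> y)" for x y
      using invariant[of "f n" x y] Suc by (simp add: f_Suc)
    ultimately show ?case by (simp add: f_Suc)
  qed
  have fadm: "admissible K D (f n)" for n using f by (intro adm) auto
  \<comment> \<open>Converts the bound 1 + K (\<omega> x + \<omega> y) on the first increment into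
    the weight 2 + \<beta> (\<omega> x + \<omega> y).\<close>
  define C where "C = 1 + K / \<beta>"
  have C: "0 < C" using K \<beta> by (simp add: C_def add_pos_nonneg)
  have step: "(f (Suc n) x - f n x) - (f (Suc n) y - f n y) \<le> q ^ n * C * (2 + \<beta> * (\<omega> x + \<omega> y))" for n x y
  proof (induction n arbitrary: x y)
    case 0
    have "f (Suc 0) x - f (Suc 0) y \<le> 1 + K * (\<omega> x + \<omega> y)" using f by blast
    also have "\<dots> \<le> C * 2 + C * \<beta> * (\<omega> x + \<omega> y)"
    proof (intro add_mono mult_right_mono)
      have "0 \<le> K / \<beta>" using K \<beta> by simp
      then have "1 \<le> C" by (simp add: C_def)
      then show "1 \<le> C * 2" by linarith
      show "K \<le> C * \<beta>" using \<beta> by (simp add: C_def field_simps)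
      show "0 \<le> \<omega> x + \<omega> y" using \<omega>_nonneg by simp
    qed
    finally show ?case by (simp add: f_def algebra_simps)
  next
    case (Suc n)
    have "(Bellman \<gamma> (f (Suc n)) x - Bellman \<gamma> (f n) x) - (Bellman \<gamma> (f (Suc n)) y - Bellman \<gamma> (f n) y)
        \<le> q * (q ^ n * C) * (2 + \<beta> * (\<omega> x + \<omega> y))"
      by (rule contr) (use fadm Suc q C in auto)
    then show ?case by (simp add: f_Suc mult.assoc)
  qed
  \<comment> \<open>The sum of the geometric series of increments; the factor 1 - q^k below is its
    partial sum.\<close>
  define E where "E = C / (1 - q)"
  have E: "0 < E" "C = E * (1 - q)" using C q by (auto simp: E_def)
  have tele: "(f (n + k) x - f n x) - (f (n + k) y - f n y)
      \<le> q ^ n * E * (1 - q ^ k) * (2 + \<beta> * (\<omega> x + \<omega> y))" for n k x y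
  proof (induction k)
    case (Suc k)
    then show ?case using step[of "n + k" x y] by (simp add: E(2) power_add algebra_simps)
  qed simp
  have osc: "(f (n + k) x - f n x) - (f (n + k) y - f n y)
      \<le> q ^ n * E * (2 + \<beta> * (\<omega> x + \<omega> y))" for n k x y
  proof -
    have "q ^ n * E * (1 - q ^ k) * (2 + \<beta> * (\<omega> x + \<omega> y)) \<le> q ^ n * E * 1 * (2 + \<beta> * (\<omega> x + \<omega> y))"
      using q E \<beta> \<omega>_nonneg by (intro mult_right_mono mult_left_mono) (auto simp: add_nonneg_nonneg)
    then show ?thesis using tele[of n k x y] by simp
  qed
  define P where "P x = E * (2 + \<beta> * (\<omega> x + \<omega> z))" for x
  have dist_le: "\<bar>f (n + k) x - f n x\<bar> \<le> q ^ n * P x" for n k x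
    using osc[of n k x z] osc[of n k z x] f[of n] f[of "n + k"]
    by (simp add: P_def algebra_simps abs_le_iff)
  have geom: "(\<lambda>n. q ^ n * a) \<longlonglongrightarrow> 0" for a
    using q by (intro tendsto_mult_left_zero LIMSEQ_realpow_zero) auto
  have "convergent (\<lambda>n. f n x)" for x
  proof (rule Cauchy_convergent)
    show "Cauchy (\<lambda>n. f n x)"
      unfolding Cauchy_altdef2
    proof (intro allI impI)
      fix e :: real assume "0 < e"
      then obtain n0 where "\<And>n. n \<ge> n0 \<Longrightarrow> norm (q ^ n * P x - 0) < e"
        using LIMSEQ_D[OF geom] by blast
      then have n0: "q ^ n0 * P x < e" by (metis abs_ge_self diff_zero le_less_trans order_refl real_norm_def)
      have "dist (f n x) (f n0 x) < e" if "n \<ge> n0" for n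
        using dist_le[of n0 "n - n0" x] n0 that by (simp add: dist_real_def)
      then show "\<exists>N. \<forall>n\<ge>N. dist (f n x) (f N x) < e" by blast
    qed
  qed
  then obtain u where lim: "\<And>x. (\<lambda>n. f n x) \<longlonglongrightarrow> u x" unfolding convergent_def by metis
  have lim': "(\<lambda>k. f (n + k) x) \<longlonglongrightarrow> u x" for n x
    using LIMSEQ_ignore_initial_segment[OF lim[of x], of n] by (simp add: add.commute)
  have u_osc: "(u x - f n x) - (u y - f n y) \<le> q ^ n * E * (2 + \<beta> * (\<omega> x + \<omega> y))" for n x y
    by (rule LIMSEQ_le_const2[where X = "\<lambda>k. (f (n + k) x - f n x) - (f (n + k) y - f n y)"])
      (auto intro!: tendsto_intros lim' osc)
  have u_dist: "\<bar>u x - f n x\<bar> \<le> q ^ n * P x" for n x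
    by (rule LIMSEQ_le_const2[where X = "\<lambda>k. \<bar>f (n + k) x - f n x\<bar>"])
      (auto intro!: tendsto_intros lim' dist_le)
  have uz: "u z = 0"
    using LIMSEQ_unique[OF lim[of z]] f by simp
  have u_span: "u x - u y \<le> 1 + K * (\<omega> x + \<omega> y)" for x y
    by (rule LIMSEQ_le_const2[where X = "\<lambda>n. f n x - f n y"]) (use f in \<open>auto intro!: tendsto_intros lim\<close>)
  have u_cont: "continuous_on UNIV u"
  proof -
    have "isCont u x" for x
    proof -
      \<comment> \<open>Convergence is uniform only where \<omega> is bounded, so continuity of the
        limit is proved on an open sublevel set around each point.\<close>
      define V where "V = {y. \<omega> y < \<omega> x + 1}"
      have openV: "open V" unfolding V_def by (intro open_Collect_less \<omega>_continuous continuous_intros)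
      have ul: "uniform_limit V f u sequentially"
      proof (rule uniform_limitI)
        fix e :: real assume e: "0 < e"
        let ?Q = "E * (2 + \<beta> * (\<omega> x + 1 + \<omega> z))"
        have "\<forall>\<^sub>F n in sequentially. q ^ n * ?Q < e"
          using order_tendstoD(2)[OF geom e] .
        then show "\<forall>\<^sub>F n in sequentially. \<forall>y\<in>V. dist (f n y) (u y) < e"
        proof eventually_elim
          case (elim n)
          show ?case
          proof
            fix y assume "y \<in> V"
            then have "P y \<le> ?Q" unfolding P_def V_def using E \<beta> by simp
            then have "q ^ n * P y \<le> q ^ n * ?Q" using q by (intro mult_left_mono) auto
            then show "dist (f n y) (u y) < e" using u_dist[of y n] elim by (simp add: dist_real_def)
          qed
        qed
      qed
      have fV: "continuous_on V (f n)" for n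
        using f continuous_on_subset[of UNIV "f n" V] by simp
      have "continuous_on V u"
        by (rule uniform_limit_theorem[OF always_eventually[OF allI[OF fV]] ul]) simp
      then show ?thesis
        using continuous_on_eq_continuous_at[OF openV, of u] by (simp add: V_def)
    qed
    then show ?thesis by (simp add: continuous_at_imp_continuous_on)
  qed
  have uadm: "admissible K D u" by (rule adm[OF u_cont uz u_span])
  have "Bellman \<gamma> u x = u x + Bellman \<gamma> u z" for x
  proof -
    \<comment> \<open>The limit lies in the same ball as the iterates, so the contraction also
      compares \<open>u\<close> with \<open>f n\<close>. The normalised images then converge to that
      of \<open>u\<close>, but they are themselves the shifted sequence of iterates.\<close>
    have le: "(Bellman \<gamma> u x - Bellman \<gamma> (f n) x) - (Bellman \<gamma> u y - Bellman \<gamma> (f n) y)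
        \<le> q * (q ^ n * E) * (2 + \<beta> * (\<omega> x + \<omega> y))" for n x y
      by (rule contr) (use uadm fadm u_osc q E in auto)
    have "\<bar>f (Suc n) x - (Bellman \<gamma> u x - Bellman \<gamma> u z)\<bar> \<le> q ^ Suc n * P x" for n
      using le[of x n z] le[of z n x]
      by (simp add: f_Suc P_def abs_le_iff algebra_simps)
    then have "(\<lambda>n. f (Suc n) x - (Bellman \<gamma> u x - Bellman \<gamma> u z)) \<longlonglongrightarrow> 0"
      by (intro Lim_null_comparison[OF _ LIMSEQ_Suc[OF geom[of "P x"]]]) auto
    then have "(\<lambda>n. f (Suc n) x) \<longlonglongrightarrow> Bellman \<gamma> u x - Bellman \<gamma> u z" by (rule LIM_zero_cancel) 
    then show ?thesis using LIMSEQ_unique[OF LIMSEQ_Suc[OF lim[of x]]] by force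
  qed
  then show ?thesis using uadm by blast
qed

text \<open>Constants cancel in differences, so the operator leaves (u x - v x) - (u y - v y)
  unchanged even if \<open>c\<close> and \<open>c'\<close> differ. The contraction can thus be
  applied to the same quantity arbitrarily often, which forces it to vanish.\<close>

lemma Bellman_fixed_point_unique:
  assumes K: "0 \<le> K" and u: "admissible K D u" and v: "admissible K D v"
    and fixed: "\<And>x. Bellman \<gamma> u x = u x + c" "\<And>x. Bellman \<gamma> v x = v x + c'"
  shows "\<exists>d. \<forall>x. v x = u x + d"
proof -
  obtain \<beta> q where \<beta>: "0 < \<beta>" and q: "0 < q" "q < 1"
    and "contracts \<gamma> K D \<beta> q"
    using Bellman_contraction[OF K, of \<gamma> D] .
  note contr = contractsD[OF this(4)]
  \<comment> \<open>Chosen to dominate the crude bound 4 D + 2 K (\<omega> x + \<omega> y);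
    \<open>D\<close> has no prescribed sign, and the summand 1 ensures positivity.\<close>
  define C where "C = 2 * \<bar>D\<bar> + 2 * K / \<beta> + 1"
  have C: "0 < C" using K \<beta> by (simp add: C_def add_nonneg_pos)
  have le: "(u x - v x) - (u y - v y) \<le> q ^ n * C * (2 + \<beta> * (\<omega> x + \<omega> y))" for n x y
  proof (induction n arbitrary: x y)
    case 0
    have "\<bar>u x\<bar> \<le> D + K * \<omega> x" "\<bar>v x\<bar> \<le> D + K * \<omega> x" "\<bar>u y\<bar> \<le> D + K * \<omega> y" "\<bar>v y\<bar> \<le> D + K * \<omega> y"
      using u v by (auto simp: admissible_def)
    then have "(u x - v x) - (u y - v y) \<le> 4 * D + 2 * K * (\<omega> x + \<omega> y)"
      by (simp add: distrib_left)
    also have "\<dots> \<le> C * 2 + C * \<beta> * (\<omega> x + \<omega> y)"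
    proof (intro add_mono mult_right_mono)
      have "0 \<le> 2 * K / \<beta>" using K \<beta> by simp
      then show "4 * D \<le> C * 2" by (simp add: C_def)
      show "2 * K \<le> C * \<beta>" using \<beta> by (simp add: C_def field_simps)
      show "0 \<le> \<omega> x + \<omega> y" using \<omega>_nonneg by simp
    qed
    finally show ?case by (simp add: algebra_simps)
  next
    case (Suc n)
    have "(Bellman \<gamma> u x - Bellman \<gamma> v x) - (Bellman \<gamma> u y - Bellman \<gamma> v y)
        \<le> q * (q ^ n * C) * (2 + \<beta> * (\<omega> x + \<omega> y))"
      by (rule contr) (use u v Suc q C in auto)
    then show ?case by (simp add: fixed mult.assoc)
  qed
  have "(\<lambda>n. q ^ n * (C * (2 + \<beta> * (\<omega> x + \<omega> y)))) \<longlonglongrightarrow> 0" for x y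
    using q by (intro tendsto_mult_left_zero LIMSEQ_realpow_zero) auto
  then have "(u x - v x) - (u y - v y) \<le> 0" for x y
    by (rule LIMSEQ_le_const) (use le in \<open>auto simp: mult.assoc\<close>)
  then have "u x - v x = u y - v y" for x y by (metis diff_le_0_iff_le order_antisym)
  then have "v x = u x + (v undefined - u undefined)" for x by (smt (verit))
  then show ?thesis by blast
qed

section \<open>Translation of the extended-real equation and of the function space\<close>

lemma Bellman_eq_INF:
  assumes f: "admissible K D f" "0 \<le> K"
  shows "(INF h\<in>U. ln_ennreal (\<integral>\<^sup>+w. ennreal (exp (\<gamma> * F x h w + f (G x w))) \<partial>N)) = ereal (Bellman \<gamma> f x)"
proof -
  have eq: "ln_ennreal (\<integral>\<^sup>+w. ennreal (exp (\<gamma> * F x h w + f (G x w))) \<partial>N) = ereal (log_mgf \<gamma> f x h)"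
    if h: "h \<in> U" for h
  proof -
    have "(\<integral>\<^sup>+w. ennreal (exp (exponent \<gamma> f x h w)) \<partial>N) = ennreal (\<integral>w. exp (exponent \<gamma> f x h w) \<partial>N)"
      by (intro nn_integral_eq_integral integrable_exp_exponent[OF f h]) auto
    then show ?thesis
      using integral_exp_exponent_pos[OF f h, of \<gamma> x]
      by (simp add: exponent_def[symmetric] ln_ennreal_def log_mgf_def)
  qed
  obtain h where h: "h \<in> U" "Bellman \<gamma> f x = log_mgf \<gamma> f x h" using Bellman_attained[OF f] by metis
  have "(INF h\<in>U. ln_ennreal (\<integral>\<^sup>+w. ennreal (exp (\<gamma> * F x h w + f (G x w))) \<partial>N))
      = (INF h\<in>U. ereal (log_mgf \<gamma> f x h))"
    by (intro INF_cong) (auto simp: eq)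
  also have "\<dots> = ereal (Bellman \<gamma> f x)"
    by (intro antisym INF_greatest INF_lower2[of h]) (use h Bellman_le[OF f, of _ \<gamma> x] in auto)
  finally show ?thesis .
qed

lemma weighted_continuous_iff_admissible:
  "f \<in> weighted_continuous \<omega> \<longleftrightarrow> (\<exists>L\<ge>0. admissible L L f)"
proof
  assume "f \<in> weighted_continuous \<omega>"
  then have c: "continuous_on UNIV f" and fin: "weighted_norm \<omega> f < \<infinity>"
    by (auto simp: weighted_continuous_def)
  have le: "ereal (\<bar>f x\<bar> / (1 + \<omega> x)) \<le> weighted_norm \<omega> f" for x
    unfolding weighted_norm_def by (rule SUP_upper) auto
  have pos: "0 < 1 + \<omega> x" for x using \<omega>_nonneg[of x] by simp
  have "0 \<le> weighted_norm \<omega> f"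
    by (rule order_trans[OF _ le[of undefined]]) (use pos in \<open>simp add: less_imp_le\<close>)
  then obtain L where L: "weighted_norm \<omega> f = ereal L" "0 \<le> L" using fin by (cases "weighted_norm \<omega> f") auto
  have "\<bar>f x\<bar> \<le> L + L * \<omega> x" for x
    using le[of x] pos[of x] by (simp add: L pos_divide_le_eq algebra_simps)
  then show "\<exists>L\<ge>0. admissible L L f" using c L by (auto simp: admissible_def)
next
  assume "\<exists>L\<ge>0. admissible L L f"
  then obtain L where L: "0 \<le> L" "continuous_on UNIV f" "\<And>x. \<bar>f x\<bar> \<le> L + L * \<omega> x"
    by (auto simp: admissible_def)
  have "ereal (\<bar>f x\<bar> / (1 + \<omega> x)) \<le> ereal L" for x
    using L(3)[of x] \<omega>_nonneg[of x] by (simp add: pos_divide_le_eq algebra_simps)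
  then have "weighted_norm \<omega> f \<le> ereal L"
    unfolding weighted_norm_def by (intro SUP_least)
  then show "f \<in> weighted_continuous \<omega>" using L by (auto simp: weighted_continuous_def)
qed

end

section \<open>Consequences of the growth and minorization hypotheses\<close>

lemma (in prob_space) integrable_exp_of_entropic_utility:
  assumes [measurable]: "Z \<in> borel_measurable M" and "\<bar>entropic_utility M \<gamma> Z\<bar> \<noteq> \<infinity>"
  shows "integrable M (\<lambda>s. exp (\<gamma> * Z s))"
proof (cases "\<gamma> = 0")
  case False
  let ?I = "\<integral>\<^sup>+ s. ennreal (exp (\<gamma> * Z s)) \<partial>M"
  have "?I \<noteq> \<top>"
  proof
    assume "?I = \<top>"
    \<comment> \<open>The sign of \<gamma> decides which infinity this is; finiteness excludes
      both.\<close>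
    then have "entropic_utility M \<gamma> Z = ereal (1 / \<gamma>) * \<infinity>"
      using False by (simp add: entropic_utility_def ln_ennreal_def)
    then show False using assms(2) False by (simp add: times_ereal.simps split: if_splits)
  qed
  then show ?thesis by (intro integrableI_nonneg) (auto simp: less_top)
qed simp

text \<open>Both laws dominate the same measure c \<nu>, and the \<nu>-integrals of \<psi> and 1 -
  \<psi> add up to 1.\<close>

lemma (in prob_space) overlap_of_minorization:
  fixes X Y :: "'a \<Rightarrow> 'b::topological_space" and \<psi> :: "'b \<Rightarrow> real"
  assumes [measurable]: "X \<in> borel_measurable M" "Y \<in> borel_measurable M"
    and \<nu>: "prob_space \<nu>" "sets \<nu> = sets borel"
    and minor: "\<And>A. A \<in> sets borel \<Longrightarrow> ennreal c * emeasure \<nu> A \<le> emeasure M {s\<in>space M. X s \<in> A}"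
      "\<And>A. A \<in> sets borel \<Longrightarrow> ennreal c * emeasure \<nu> A \<le> emeasure M {s\<in>space M. Y s \<in> A}"
    and [measurable]: "\<psi> \<in> borel_measurable borel" and \<psi>: "\<And>z. 0 \<le> \<psi> z" "\<And>z. \<psi> z \<le> 1"
  shows "c \<le> (\<integral>s. \<psi> (X s) \<partial>M) + (\<integral>s. 1 - \<psi> (Y s) \<partial>M)"
proof -
  interpret \<nu>: prob_space \<nu> by fact
  have [measurable_cong]: "sets \<nu> = sets borel" by fact
  have le: "ennreal c * (\<integral>\<^sup>+z. ennreal (g z) \<partial>\<nu>) \<le> ennreal (\<integral>s. g (Z s) \<partial>M)"
    if [measurable]: "Z \<in> borel_measurable M" "g \<in> borel_measurable borel"
      and g: "\<And>z. 0 \<le> g z" "\<And>z. g z \<le> 1"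
      and Z: "\<And>A. A \<in> sets borel \<Longrightarrow> ennreal c * emeasure \<nu> A \<le> emeasure M {s\<in>space M. Z s \<in> A}"
    for Z :: "'a \<Rightarrow> 'b" and g :: "'b \<Rightarrow> real"
  proof -
    \<comment> \<open>Domination on sets is the order on measures, which passes to integrals of
      nonnegative functions.\<close>
    have "scale_measure (ennreal c) \<nu> \<le> distr M borel Z"
      using Z by (subst le_measure) (auto simp: \<nu>(2) emeasure_distr vimage_def Int_def conj_commute)
    then have "nn_integral (scale_measure (ennreal c) \<nu>) g \<le> nn_integral (distr M borel Z) g"
      by (intro nn_integral_mono_measure) (auto simp: \<nu>(2))
    also have "nn_integral (scale_measure (ennreal c) \<nu>) g = ennreal c * (\<integral>\<^sup>+z. ennreal (g z) \<partial>\<nu>)"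
      by (rule nn_integral_scale_measure) measurable
    also have "nn_integral (distr M borel Z) g = (\<integral>\<^sup>+s. ennreal (g (Z s)) \<partial>M)"
      by (rule nn_integral_distr) measurable
    also have "\<dots> = ennreal (\<integral>s. g (Z s) \<partial>M)"
      by (intro nn_integral_eq_integral integrable_const_bound[of _ 1]) (use g in auto)
    finally show ?thesis .
  qed
  have one: "(\<integral>\<^sup>+z. ennreal (\<psi> z) \<partial>\<nu>) + (\<integral>\<^sup>+z. ennreal (1 - \<psi> z) \<partial>\<nu>) = 1"
  proof -
    have "(\<integral>\<^sup>+z. ennreal (\<psi> z) \<partial>\<nu>) + (\<integral>\<^sup>+z. ennreal (1 - \<psi> z) \<partial>\<nu>)
        = (\<integral>\<^sup>+z. ennreal (\<psi> z) + ennreal (1 - \<psi> z) \<partial>\<nu>)"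
      by (rule nn_integral_add[symmetric]) measurable
    also have "\<dots> = (\<integral>\<^sup>+z. 1 \<partial>\<nu>)"
      using \<psi> by (intro nn_integral_cong) (simp flip: ennreal_plus)
    finally show ?thesis by (simp add: \<nu>.emeasure_space_1)
  qed
  have "ennreal c = ennreal c * ((\<integral>\<^sup>+z. ennreal (\<psi> z) \<partial>\<nu>) + (\<integral>\<^sup>+z. ennreal (1 - \<psi> z) \<partial>\<nu>))"
    by (simp add: one)
  also have "\<dots> \<le> ennreal (\<integral>s. \<psi> (X s) \<partial>M) + ennreal (\<integral>s. 1 - \<psi> (Y s) \<partial>M)"
    unfolding distrib_left
    by (intro add_mono le minor) (use \<psi> in auto)
  also have "\<dots> = ennreal ((\<integral>s. \<psi> (X s) \<partial>M) + (\<integral>s. 1 - \<psi> (Y s) \<partial>M))"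
    using \<psi> by (intro ennreal_plus[symmetric]) auto
  finally show ?thesis
    using \<psi> by (subst (asm) ennreal_le_iff) auto
qed

theorem proposition4p8:
  fixes M :: "'a measure"
    and \<FF> :: "nat \<Rightarrow> 'a measure"
    and U :: "(real ^ 'm::finite) set"
    and W :: "nat \<Rightarrow> 'a \<Rightarrow> real ^ ('k::finite + 'm)"
    and G :: "real ^ 'k \<Rightarrow> real ^ ('k + 'm) \<Rightarrow> real ^ 'k"
    and x\<^sub>0 :: "real ^ 'k"
    and X :: "nat \<Rightarrow> 'a \<Rightarrow> real ^ 'k"
    and F :: "real ^ 'k \<Rightarrow> real ^ 'm \<Rightarrow> real ^ ('k + 'm) \<Rightarrow> real"
    and v\<^sub>0 :: real
    and V :: "(nat \<Rightarrow> 'a \<Rightarrow> real ^ 'm) \<Rightarrow> nat \<Rightarrow> 'a \<Rightarrow> real"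
    and a\<^sub>1 a\<^sub>2 :: "real ^ ('k + 'm) \<Rightarrow> real"
    and b\<^sub>1 b\<^sub>2 :: real
    and \<omega> :: "real ^ 'k \<Rightarrow> real"
  assumes "filtered_prob_space M \<FF>"
    and "compact U" and "U \<noteq> {}"
    and "noise M \<FF> W"
    and "factors M W G x\<^sub>0 X"
    and "portfolio M \<FF> U W X F v\<^sub>0 V"
    and "growth M U W G F a\<^sub>1 a\<^sub>2 b\<^sub>1 b\<^sub>2 \<omega>"
    and "minorization M W G \<omega>"
  shows "\<exists>\<gamma>\<^sub>0<0. \<forall>\<gamma>. \<gamma>\<^sub>0 < \<gamma> \<and> \<gamma> < 0 \<longrightarrow>
           (\<exists>u\<in>weighted_continuous \<omega>. \<exists>lam::real.
              solves_Bellman M U W G F \<gamma> u lam \<and>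
              (\<forall>u'\<in>weighted_continuous \<omega>. \<forall>lam'::real.
                 solves_Bellman M U W G F \<gamma> u' lam' \<longrightarrow> (\<exists>c::real. \<forall>x. u' x = u x + c)))"
proof -
  interpret M: prob_space M using assms(1) by (simp add: filtered_prob_space_def)
  have W[measurable]: "W 0 \<in> borel_measurable M"
    using assms(4) by (auto simp: noise_def M.indep_vars_def2)
  define N where "N = distr M borel (W 0)"
  have sets_N[simp, measurable_cong]: "sets N = sets borel" by (simp add: N_def)
  have g: "a\<^sub>1 \<in> borel_measurable borel" "\<And>w. 0 \<le> a\<^sub>1 w" "a\<^sub>2 \<in> borel_measurable borel" "\<And>w. 0 \<le> a\<^sub>2 w"
    "0 < b\<^sub>1" "b\<^sub>1 < 1" "0 < b\<^sub>2" "continuous_on UNIV \<omega>" "\<And>x. 0 \<le> \<omega> x"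
    "\<And>x w. \<omega> (G x w) \<le> a\<^sub>1 w + b\<^sub>1 * \<omega> x"
    "\<And>x h w. h \<in> U \<Longrightarrow> \<bar>F x h w\<bar> \<le> a\<^sub>2 w + b\<^sub>2 * \<omega> x"
    "\<And>\<gamma>. \<bar>entropic_utility M \<gamma> (\<lambda>s. a\<^sub>1 (W 0 s))\<bar> \<noteq> \<infinity>"
    "\<And>\<gamma>. \<bar>entropic_utility M \<gamma> (\<lambda>s. a\<^sub>2 (W 0 s))\<bar> \<noteq> \<infinity>"
    using assms(7) by (simp_all add: growth_def)
  note [measurable] = g(1,3)
  have G_meas[measurable]: "G x \<in> borel_measurable borel" for x
  proof -
    have "(\<lambda>w. (x, w)) \<in> borel \<rightarrow>\<^sub>M borel"
      by (intro borel_measurable_continuous_onI continuous_intros)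
    from measurable_compose[OF this, of "\<lambda>(x, w). G x w"] assms(5)
    show ?thesis by (simp add: factors_def)
  qed
  have F_meas: "F x h \<in> borel_measurable borel" if "h \<in> U" for x h
  proof -
    have "(\<lambda>w. (x, h, w)) \<in> borel \<rightarrow>\<^sub>M restrict_space borel (UNIV \<times> U \<times> UNIV)"
      using that by (intro measurable_restrict_space2 borel_measurable_continuous_onI continuous_intros) auto
    from measurable_compose[OF this, of "\<lambda>(x, h, w). F x h w"] assms(6)
    show ?thesis by (simp add: portfolio_def)
  qed
  interpret controlled_factor N U G F a\<^sub>1 a\<^sub>2 b\<^sub>1 b\<^sub>2 \<omega>
  proof (intro controlled_factor.intro controlled_factor_axioms.intro)
    show "prob_space N" unfolding N_def by (rule M.prob_space_distr) measurable
    show "continuous_on UNIV (\<lambda>x. G x w)" for w using assms(5) by (simp add: factors_def)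
    show "continuous_on (UNIV \<times> U) (\<lambda>(x, h). F x h w)" for w using assms(6) by (simp add: portfolio_def)
    show "integrable N (\<lambda>w. exp (\<theta> * a\<^sub>1 w))" for \<theta>
      unfolding N_def
      by (subst integrable_distr_eq) (auto intro!: M.integrable_exp_of_entropic_utility g(12))
    show "integrable N (\<lambda>w. exp (\<theta> * a\<^sub>2 w))" for \<theta>
      unfolding N_def
      by (subst integrable_distr_eq) (auto intro!: M.integrable_exp_of_entropic_utility g(13))
    show "\<exists>c>0. \<forall>x y. \<forall>\<psi>\<in>borel_measurable borel.
      \<omega> x \<le> R \<longrightarrow> \<omega> y \<le> R \<longrightarrow> (\<forall>z. 0 \<le> \<psi> z \<and> \<psi> z \<le> (1::real)) \<longrightarrow>
      c \<le> (\<integral>w. \<psi> (G x w) \<partial>N) + (\<integral>w. 1 - \<psi> (G y w) \<partial>N)" if R: "0 < R" for R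
    proof -
      obtain c \<nu> where c: "0 < c" and \<nu>: "prob_space \<nu>" "sets \<nu> = sets borel"
        and minor: "\<And>A. A \<in> sets borel \<Longrightarrow> ennreal c * emeasure \<nu> A
          \<le> (INF x\<in>{x. \<omega> x \<le> R}. emeasure M {s\<in>space M. G x (W 0 s) \<in> A})"
        using assms(8)[unfolded minorization_def, rule_format, OF R] by auto
      have le: "ennreal c * emeasure \<nu> A \<le> emeasure M {s\<in>space M. G x (W 0 s) \<in> A}"
        if "\<omega> x \<le> R" "A \<in> sets borel" for x A
        by (rule order_trans[OF minor[OF that(2)] INF_lower]) (use that in simp)
      have "c \<le> (\<integral>w. \<psi> (G x w) \<partial>N) + (\<integral>w. 1 - \<psi> (G y w) \<partial>N)"
        if [measurable]: "\<psi> \<in> borel_measurable borel" and "\<omega> x \<le> R" "\<omega> y \<le> R"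
          and "\<And>z. 0 \<le> \<psi> z \<and> \<psi> z \<le> (1::real)" for \<psi> x y
      proof -
        have "c \<le> (\<integral>s. \<psi> (G x (W 0 s)) \<partial>M) + (\<integral>s. 1 - \<psi> (G y (W 0 s)) \<partial>M)"
          by (rule M.overlap_of_minorization[OF _ _ \<nu>]) (use le that in auto)
        then show ?thesis unfolding N_def by (simp add: integral_distr)
      qed
      then show ?thesis using c by blast
    qed
  qed (use assms(2,3) g(1-11) G_meas F_meas in \<open>simp_all cong: measurable_cong_sets\<close>)
  have solves: "solves_Bellman M U W G F \<gamma> u lam \<longleftrightarrow> (\<forall>x. Bellman \<gamma> u x = u x + lam * \<gamma>)"
    if "admissible K D u" "0 \<le> K" for K D u \<gamma> lam
  proof -
    have "(\<integral>\<^sup>+s. ennreal (exp (\<gamma> * F x h (W 0 s) + u (G x (W 0 s)))) \<partial>M)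
        = (\<integral>\<^sup>+w. ennreal (exp (\<gamma> * F x h w + u (G x w))) \<partial>N)" if h: "h \<in> U" for x h
    proof -
      note [measurable] = F_meas[OF h] admissible_measurable[OF \<open>admissible K D u\<close>]
      show ?thesis unfolding N_def by (subst nn_integral_distr) auto
    qed
    then have "(INF h\<in>U. ln_ennreal (\<integral>\<^sup>+s. ennreal (exp (\<gamma> * F x h (W 0 s) + u (G x (W 0 s)))) \<partial>M))
        = ereal (Bellman \<gamma> u x)" for x
      by (simp add: Bellman_eq_INF[OF that, symmetric] cong: INF_cong)
    then show ?thesis unfolding solves_Bellman_def by (metis ereal.inject)
  qed
  obtain t where t: "0 < t" and inv: "\<And>\<gamma> f x y. \<lbrakk>\<bar>\<gamma>\<bar> < t; continuous_on UNIV f;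
      \<forall>x y. f x - f y \<le> 1 + \<bar>\<gamma>\<bar> * \<kappa> * (\<omega> x + \<omega> y)\<rbrakk> \<Longrightarrow>
      Bellman \<gamma> f x - Bellman \<gamma> f y \<le> 1 + \<bar>\<gamma>\<bar> * \<kappa> * (\<omega> x + \<omega> y)"
    using Bellman_invariant by blast
  show ?thesis
  proof (intro exI[of _ "- t"] conjI allI impI)
    fix \<gamma> assume \<gamma>: "- t < \<gamma> \<and> \<gamma> < 0"
    have K: "0 \<le> \<bar>\<gamma>\<bar> * \<kappa>" using \<kappa> by simp
    obtain u D c where u: "admissible (\<bar>\<gamma>\<bar> * \<kappa>) D u" and fixed: "\<And>x. Bellman \<gamma> u x = u x + c"
      using Bellman_fixed_point[OF K, of \<gamma>] inv[of \<gamma>] \<gamma> by auto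
    \<comment> \<open>Membership in C\<omega> asks for one number that serves both as slope and as
      constant.\<close>
    define L where "L = max (\<bar>\<gamma>\<bar> * \<kappa>) D"
    have uL: "admissible L L u" by (rule admissible_mono[OF u]) (auto simp: L_def)
    have L: "0 \<le> L" using K by (simp add: L_def)
    show "\<exists>u\<in>weighted_continuous \<omega>. \<exists>lam::real. solves_Bellman M U W G F \<gamma> u lam \<and>
        (\<forall>u'\<in>weighted_continuous \<omega>. \<forall>lam'::real.
          solves_Bellman M U W G F \<gamma> u' lam' \<longrightarrow> (\<exists>c::real. \<forall>x. u' x = u x + c))"
    \<comment> \<open>The equation contains \<open>lam * \<gamma>\<close> where the fixed point has
      \<open>c\<close>; division is possible since \<gamma> < 0.\<close>
    proof (rule bexI[of _ u], rule exI[of _ "c / \<gamma>"], intro conjI ballI allI impI)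
      show "u \<in> weighted_continuous \<omega>" using uL L weighted_continuous_iff_admissible by blast
      show "solves_Bellman M U W G F \<gamma> u (c / \<gamma>)" using \<gamma> by (simp add: solves[OF u K] fixed)
      fix u' lam' assume "u' \<in> weighted_continuous \<omega>" and s: "solves_Bellman M U W G F \<gamma> u' lam'"
      then obtain L' where L': "0 \<le> L'" "admissible L' L' u'"
        using weighted_continuous_iff_admissible by blast
      show "\<exists>d. \<forall>x. u' x = u x + d"
      proof (rule Bellman_fixed_point_unique)
        \<comment> \<open>A common ball for both solutions, on which one contraction rate is
          available.\<close>
        show "0 \<le> max L L'" using L by simp
        show "admissible (max L L') (max L L') u" "admissible (max L L') (max L L') u'"
          by (rule admissible_mono[OF uL] admissible_mono[OF L'(2)]; simp)+
        show "Bellman \<gamma> u x = u x + c" for x by (rule fixed)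
        show "Bellman \<gamma> u' x = u' x + lam' * \<gamma>" for x using s solves[OF L'(2,1)] by simp
      qed
    qed
  qed (use t in simp)
qed

end
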